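(* For every $n\geqslant 1$, $$R_1^n=R_\infty^n\leqslant(2n)^{\frac56},$$ where $R_\infty^n=\max\{d(X,\ell_\infty^n)\mid X\in\mathbb{BM}_n\}$ and $R_1^n=\max\{d(X,\ell_1^n)\mid X\in\mathbb{BM}_n\}$.
   Context: $\mathbb{BM}_n$ is the space of all $n$-dimensional (real) normed spaces (the Banach-Mazur compactum). For $X,Y\in\mathbb{BM}_n$, the Banach-Mazur distance is $d(X,Y)=\inf\{\|T\|\cdot\|T^{-1}\| \mid T \text{ is a linear isomorphism between } X \text{ and } Y\}$. $\ell_p^n$ is $\mathbb{R}^n$ with the $\ell_p$ norm. *)

theory Defs
  imports "HOL-Analysis.Analysis"
begin

text \<open>An \<open>n\<close>-dimensional real normed space is represented by a norm function on the coordinate space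
  \<open>real ^ 'n\<close> with \<open>n = CARD('n)\<close>: after a choice of basis, every such space is isometric to one of
  these, and the Banach-Mazur distance only depends on isometry classes.  The three clauses are the
  axioms of the class \<open>real_normed_vector\<close>; nonnegativity follows from them.\<close>

definition is_norm :: "('a::real_vector \<Rightarrow> real) \<Rightarrow> bool" where
  "is_norm N \<longleftrightarrow>
     (\<forall>x. N x = 0 \<longleftrightarrow> x = 0) \<and>
     (\<forall>x y. N (x + y) \<le> N x + N y) \<and>
     (\<forall>c x. N (c *\<^sub>R x) = \<bar>c\<bar> * N x)"

text \<open>The analogue of \<^const>\<open>onorm\<close> for explicitly given norms.  In finite dimension the set is bounded
  above for linear \<open>T\<close>, so the supremum is a genuine one; at \<open>x = 0\<close> the quotient is \<open>0\<close>.\<close>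

definition op_norm ::
    "('a::real_vector \<Rightarrow> real) \<Rightarrow> ('b::real_vector \<Rightarrow> real) \<Rightarrow> ('a \<Rightarrow> 'b) \<Rightarrow> real" where
  "op_norm N M T = (SUP x. M (T x) / N x)"

definition bm_dist :: "('a::real_vector \<Rightarrow> real) \<Rightarrow> ('b::real_vector \<Rightarrow> real) \<Rightarrow> real" where
  "bm_dist N M = Inf {op_norm N M T * op_norm M N (inv T) | T. linear T \<and> bij T}"

definition l1_norm :: "real ^ 'n \<Rightarrow> real" where
  "l1_norm x = (\<Sum>i\<in>UNIV. \<bar>x $ i\<bar>)"

definition linf_norm :: "real ^ 'n \<Rightarrow> real" where
  "linf_norm x = Max (range (\<lambda>i. \<bar>x $ i\<bar>))"

lemma linf_norm_eq_infnorm: "linf_norm x = infnorm x"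
  by (simp add: linf_norm_def infnorm_cart full_SetCompr_eq cSup_eq_Max)

text \<open>Stated as a relation, since \<^const>\<open>Max\<close> is only meaningful for finite sets: \<open>m\<close> is an
  attained maximum of \<open>S\<close>.\<close>

definition is_max :: "'a::order \<Rightarrow> 'a set \<Rightarrow> bool" where
  "is_max m S \<longleftrightarrow> m \<in> S \<and> (\<forall>s\<in>S. s \<le> m)"

end

theory Submission
  imports Defs "HOL-Complex_Analysis.Great_Picard"
begin

text \<open>
  Duality exchanges the distances to \<open>l1\<close> and to \<open>linf\<close>, so only \<open>l1\<close> has to be considered.  Put the
  norm \<open>N\<close> into the position in which the Euclidean ball is the ellipsoid of minimal volume containing
  the unit ball, so that \<open>|x| \<le> N x \<le> sqrt n |x|\<close>.  John's condition at the contact points, in the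
  form that every operator of negative trace has \<open>w \<bullet> H w \<le> 0\<close> at some contact point \<open>w\<close>, feeds the
  barrier argument of Spielman and Srivastava: for \<open>0 < \<epsilon> < 1\<close> there are \<open>k = \<lfloor>(1 - \<epsilon>)\<^sup>2 n\<rfloor>\<close> contact points
  with \<open>|\<Sum> a\<^sub>w w| \<ge> \<epsilon> |a|\<close>.  Completing them by \<open>n - k\<close> orthonormal vectors scaled by \<open>1 / sqrt n\<close> gives a
  map from \<open>l1\<close> of distortion at most \<open>sqrt (k / \<epsilon>\<^sup>2 + (n - k) n)\<close>, which is at most \<open>(2 n)\<^bsup>5/6\<^esup>\<close> for
  \<open>\<epsilon> = (2 n)\<^bsup>-1/3\<^esup>\<close>.  The maximum is attained because the norms in this position form a compact set
  on which the distance to \<open>l1\<close> is continuous.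
\<close>

section \<open>Restricted invertibility\<close>

definition tr :: "('a::euclidean_space \<Rightarrow> 'a) \<Rightarrow> real" where
  "tr f = (\<Sum>b\<in>Basis. b \<bullet> f b)"

lemma tr_add: "tr (\<lambda>x. f x + g x) = tr f + tr g"
  by (simp add: tr_def inner_add_right sum.distrib)

lemma tr_diff: "tr (\<lambda>x. f x - g x) = tr f - tr g"
  by (simp add: tr_def inner_diff_right sum_subtractf)

lemma tr_scaleR: "tr (\<lambda>x. c *\<^sub>R f x) = c * tr f"
  by (simp add: tr_def sum_distrib_left)

lemma tr_ident: "tr (\<lambda>x::'a::euclidean_space. x) = DIM('a)"
  by (simp add: tr_def)

lemma tr_rank_one: "tr (\<lambda>x. (u \<bullet> x) *\<^sub>R v) = u \<bullet> v"
  by (simp add: tr_def euclidean_inner[of u v] inner_commute mult.commute)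

lemma tr_nonneg: "(\<And>x. 0 \<le> x \<bullet> f x) \<Longrightarrow> 0 \<le> tr f"
  by (simp add: tr_def sum_nonneg)

section \<open>Barriers, resolvents and the barrier potential\<close>

definition self_adjoint :: "('a::real_inner \<Rightarrow> 'a) \<Rightarrow> bool" where
  "self_adjoint f \<longleftrightarrow> linear f \<and> (\<forall>x y. f x \<bullet> y = x \<bullet> f y)"

text \<open>Here \<open>P\<close> is the orthogonal projection onto the kernel of \<open>A\<close>, and all the other eigenvalues of
  \<open>A\<close> exceed \<open>b\<close>.  Carrying \<open>P\<close> along avoids any appeal to the spectral theorem.\<close>

definition above_barrier :: "('a::euclidean_space \<Rightarrow> 'a) \<Rightarrow> ('a \<Rightarrow> 'a) \<Rightarrow> real \<Rightarrow> bool" where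
  "above_barrier A P b \<longleftrightarrow> self_adjoint A \<and> self_adjoint P \<and> (\<forall>x. P (P x) = P x) \<and>
     (\<forall>x. P (A x) = 0) \<and> (\<forall>x. P x = 0 \<longrightarrow> x \<noteq> 0 \<longrightarrow> b * (x \<bullet> x) < x \<bullet> A x)"

text \<open>The inverse of \<open>A - b\<close>. For self-adjoint \<open>A\<close> its trace is the
  sum of \<open>1 / (\<lambda> - b)\<close> over the eigenvalues, the barrier potential: an upper
  bound on it keeps the eigenvalues beyond the barrier from crowding near it.\<close>

definition resolvent :: "('a::real_vector \<Rightarrow> 'a) \<Rightarrow> real \<Rightarrow> ('a \<Rightarrow> 'a) \<Rightarrow> bool" where
  "resolvent A b R \<longleftrightarrow> linear R \<and> (\<forall>x. R (A x - b *\<^sub>R x) = x) \<and> (\<forall>x. A (R x) - b *\<^sub>R R x = x)"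

lemma above_barrier_mono:
  assumes "above_barrier A P b" "b' \<le> b" shows "above_barrier A P b'"
proof -
  have "b' * (x \<bullet> x) \<le> b * (x \<bullet> x)" for x :: 'a
    using assms(2) by (simp add: mult_right_mono)
  then show ?thesis using assms(1) unfolding above_barrier_def
    by (meson order_le_less_trans)
qed

text \<open>An eigenvector of \<open>A\<close> for \<open>b > 0\<close> is a multiple of its image
  under \<open>A\<close>, hence killed by \<open>P\<close>, and the barrier inequality rules it out.
  In finite dimension injectivity suffices.\<close>

lemma resolvent_exists:
  assumes "above_barrier A P b" "0 < b"
  shows "\<exists>R. resolvent A b R"
proof -
  have lA: "linear A" and lP: "linear P"
    using assms by (auto simp: above_barrier_def self_adjoint_def)
  let ?N = "\<lambda>x. A x - b *\<^sub>R x"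
  have lin: "linear ?N"
    by (intro linear_compose_sub lA linear_compose_scale_right linear_ident)
  have "x = 0" if "A x - b *\<^sub>R x = 0" for x
  proof (rule ccontr)
    assume "x \<noteq> 0"
    have eq: "A x = b *\<^sub>R x" using that by simp
    have "P (A x) = 0" using assms by (auto simp: above_barrier_def)
    then have "b *\<^sub>R P x = 0" using eq lP by (simp add: linear_cmul)
    then have "P x = 0" using assms(2) by simp
    then have "b * (x \<bullet> x) < x \<bullet> A x" using assms(1) \<open>x \<noteq> 0\<close> by (auto simp: above_barrier_def)
    then show False by (simp add: eq)
  qed
  then have "inj ?N" using lin by (simp add: linear_injective_0)
  from linear_injective_isomorphism[OF lin this] show ?thesis
    by (auto simp: resolvent_def)
qed

text \<open>\<open>A\<close> and \<open>R\<close> respect the orthogonal splitting into range and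
  kernel of \<open>P\<close>: on the range \<open>A\<close> is \<open>0\<close>, so \<open>R\<close>
  is \<open>- 1 / b\<close>; on the kernel \<open>A - b\<close> is positive, and so is its
  inverse.\<close>

lemma resolvent_properties:
  assumes B: "above_barrier A P b" and b: "0 < b" and R: "resolvent A b R"
  shows "self_adjoint R" "P (R x) = - (1/b) *\<^sub>R P x" "R (P x) = - (1/b) *\<^sub>R P x"
    "P x = 0 \<Longrightarrow> 0 \<le> x \<bullet> R x" "R x = 0 \<Longrightarrow> x = 0"
proof -
  have lA: "linear A" and lP: "linear P" and lR: "linear R"
    using B R by (auto simp: above_barrier_def self_adjoint_def resolvent_def)
  have sA: "A x \<bullet> y = x \<bullet> A y" and sP: "P x \<bullet> y = x \<bullet> P y" and PA: "P (A x) = 0" for x y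
    using B by (auto simp: above_barrier_def self_adjoint_def)
  have R1: "R (A x - b *\<^sub>R x) = x" and R2: "A (R x) - b *\<^sub>R R x = x" for x
    using R by (auto simp: resolvent_def)
  show "self_adjoint R"
    unfolding self_adjoint_def
  proof (intro conjI allI lR)
    fix x y
    have "R x \<bullet> y = R x \<bullet> (A (R y) - b *\<^sub>R R y)" by (simp add: R2)
    also have "\<dots> = (A (R x) - b *\<^sub>R R x) \<bullet> R y"
      by (simp add: inner_diff_left inner_diff_right sA)
    finally show "R x \<bullet> y = x \<bullet> R y" by (simp add: R2)
  qed
  have PR': "P x = - b *\<^sub>R P (R x)" for x
  proof -
    have "P (A (R x) - b *\<^sub>R R x) = - b *\<^sub>R P (R x)"
      using lP by (simp add: linear_diff linear_cmul PA)
    then show ?thesis by (simp only: R2)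
  qed
  show PR: "P (R x) = - (1/b) *\<^sub>R P x" for x
    by (subst PR'[of x]) (use b in simp)
  have AP: "A (P x) = 0" for x
  proof -
    have "A (P x) \<bullet> y = 0" for y by (simp add: sA sP PA)
    then show ?thesis by (metis inner_eq_zero_iff)
  qed
  have "P x = R (A (P x) - b *\<^sub>R P x)" by (simp add: R1)
  also have "\<dots> = - b *\<^sub>R R (P x)"
    using lR by (simp add: AP linear_cmul linear_neg)
  finally have e: "P x = - b *\<^sub>R R (P x)" .
  show "R (P x) = - (1/b) *\<^sub>R P x" 
    by (subst (2) e) (use b in simp)
  show "0 \<le> x \<bullet> R x" if "P x = 0"
  proof -
    have "P (R x) = 0" using PR that by simp
    then have "b * (R x \<bullet> R x) \<le> R x \<bullet> A (R x)"
      using B lA by (cases "R x = 0") (auto simp: above_barrier_def intro: less_imp_le)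
    moreover have "x \<bullet> R x = (A (R x) - b *\<^sub>R R x) \<bullet> R x" by (simp add: R2)
    ultimately show ?thesis by (simp add: inner_diff_left inner_diff_right inner_commute)
  qed
  show "x = 0" if "R x = 0" using R2[of x] that lA by (simp add: linear_0)
qed

text \<open>The resolvent identity \<open>R - M = (b - b') R M\<close> turns the drop
  \<open>G\<close> into \<open>(b - b') * tr (R M)\<close>. On the range of \<open>P\<close> the
  products \<open>M M\<close> and \<open>R M\<close> are explicit scalars; on its kernel their
  traces satisfy \<open>0 \<le> tr (M M) \<le> tr (R M)\<close>.\<close>

lemma resolvent_traces:
  assumes B: "above_barrier A P b" and b': "0 < b'" "b' < b"
    and R: "resolvent A b R" and M: "resolvent A b' M"
  defines "G \<equiv> tr R - tr M"
  shows "tr (\<lambda>x. M (M x)) \<le> G / (b - b') + tr P * (b - b') / (b * b'^2)"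
    and "(b - b') * tr P / (b * b') \<le> G"
proof -
  have b: "0 < b" using b' by simp
  have B': "above_barrier A P b'" using above_barrier_mono[OF B] b' by simp
  have lP: "linear P" and lR: "linear R" and lM: "linear M"
    using B R M by (auto simp: above_barrier_def self_adjoint_def resolvent_def)
  have PP: "P (P x) = P x" and sP: "P x \<bullet> y = x \<bullet> P y" for x y
    using B by (auto simp: above_barrier_def self_adjoint_def)
  have R1: "R (A x - b *\<^sub>R x) = x" and R2: "A (R x) - b *\<^sub>R R x = x" for x
    using R by (auto simp: resolvent_def)
  have M1: "M (A x - b' *\<^sub>R x) = x" and M2: "A (M x) - b' *\<^sub>R M x = x" for x
    using M by (auto simp: resolvent_def)
  note PR = resolvent_properties[OF B b R] and PM = resolvent_properties[OF B' b'(1) M]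
  have sM: "M x \<bullet> y = x \<bullet> M y" for x y
    using PM(1) by (auto simp: self_adjoint_def)
  have id1: "R x - M x = (b - b') *\<^sub>R R (M x)" for x
  proof -
    have "R x = R (A (M x) - b *\<^sub>R M x + (b - b') *\<^sub>R M x)"
      using M2[of x] by (simp add: algebra_simps)
    also have "\<dots> = M x + (b - b') *\<^sub>R R (M x)"
      using lR by (simp add: linear_add linear_cmul R1)
    finally show ?thesis by simp
  qed
  have id2: "R x - M x = (b - b') *\<^sub>R M (R x)" for x
  proof -
    have "M x = M (A (R x) - b' *\<^sub>R R x - (b - b') *\<^sub>R R x)"
      using R2[of x] by (simp add: algebra_simps)
    also have "\<dots> = R x - (b - b') *\<^sub>R M (R x)"
      using lM by (simp add: linear_diff linear_cmul M1)
    finally show ?thesis by simp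
  qed
  have comm: "R (M x) = M (R x)" for x
  proof -
    have "(b - b') *\<^sub>R R (M x) = (b - b') *\<^sub>R M (R x)" using id1 id2 by metis
    then show ?thesis using b' by simp
  qed
  \<comment> \<open>\<open>Q\<close> projects onto the kernel of \<open>P\<close>, where
    \<open>R\<close> and \<open>M\<close> are positive; the traces are split along \<open>P\<close>
    and \<open>Q\<close>.\<close>
  define Q where "Q x = x - P x" for x
  have PQ: "P (Q x) = 0" for x using lP by (simp add: Q_def linear_diff PP)
  have QQ: "Q (Q x) = Q x" for x by (simp add: Q_def[of "Q x"] PQ)
  have sQ: "Q x \<bullet> y = x \<bullet> Q y" for x y
    by (simp add: Q_def inner_diff_left inner_diff_right sP)
  have QM: "Q (M x) = M (Q x)" for x using lM
    by (simp add: Q_def PM(2,3) linear_diff linear_add)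
  have QR: "Q (R x) = R (Q x)" for x using lR
    by (simp add: Q_def PR(2,3) linear_diff linear_add)
  have MM: "M (M x) = (1/b'^2) *\<^sub>R P x + M (M (Q x))" for x
  proof -
    have "M (M x) = M (M (P x + Q x))" by (simp add: Q_def)
    then show ?thesis using lM
      by (simp add: linear_add linear_diff PM(3) linear_neg linear_cmul power2_eq_square)
  qed
  have RM: "R (M x) = (1/(b*b')) *\<^sub>R P x + R (M (Q x))" for x
  proof -
    have "R (M x) = R (M (P x + Q x))" by (simp add: Q_def)
    then show ?thesis using lM lR
      by (simp add: linear_add linear_diff PM(3) PR(3) linear_neg linear_cmul mult.commute)
  qed
  have tMM: "tr (\<lambda>x. M (M x)) = tr P / b'^2 + tr (\<lambda>x. M (M (Q x)))"
    by (subst MM) (simp add: tr_add tr_scaleR del: scaleR_scaleR)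
  have tRM: "tr (\<lambda>x. R (M x)) = tr P / (b * b') + tr (\<lambda>x. R (M (Q x)))"
    by (subst RM) (simp add: tr_add tr_scaleR)
  have G: "G = (b - b') * tr (\<lambda>x. R (M x))"
    unfolding G_def by (simp add: tr_diff[symmetric] tr_scaleR[symmetric] id1)
  have nonneg: "0 \<le> tr (\<lambda>x. M (M (Q x)))"
  proof (rule tr_nonneg)
    fix x
    have "x \<bullet> M (M (Q x)) = x \<bullet> Q (M (M (Q x)))" by (simp add: QM QQ)
    also have "\<dots> = M (Q x) \<bullet> M (Q x)" using sQ[of x] sM[of "Q x"] by simp
    finally show "0 \<le> x \<bullet> M (M (Q x))" by simp
  qed
  \<comment> \<open>By the resolvent identity and commutation the difference is
    \<open>(b - b') M R M\<close> on the range of \<open>Q\<close>, a congruence of a positive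
    operator.\<close>
  have "0 \<le> tr (\<lambda>x. R (M (Q x)) - M (M (Q x)))"
  proof (rule tr_nonneg)
    fix x
    have "R (M (Q x)) - M (M (Q x)) = (b - b') *\<^sub>R R (M (M (Q x)))" by (simp add: id1)
    also have "\<dots> = (b - b') *\<^sub>R Q (M (R (M (Q x))))" by (simp add: comm QM QR QQ)
    finally have "x \<bullet> (R (M (Q x)) - M (M (Q x))) = (b - b') * (M (Q x) \<bullet> R (M (Q x)))"
      using sQ[of x] sM[of "Q x"] by simp
    moreover have "0 \<le> M (Q x) \<bullet> R (M (Q x))"
      by (rule PR(4)) (simp add: PM(2) PQ)
    ultimately show "0 \<le> x \<bullet> (R (M (Q x)) - M (M (Q x)))" using b' by simp
  qed
  then have le: "tr (\<lambda>x. M (M (Q x))) \<le> tr (\<lambda>x. R (M (Q x)))" by (simp add: tr_diff)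
  have "tr (\<lambda>x. M (M x)) \<le> tr P / b'^2 + (G / (b - b') - tr P / (b * b'))"
    using tMM tRM le G b' by simp
  also have "\<dots> = G / (b - b') + tr P * (b - b') / (b * b'^2)"
    using b b' by (simp add: field_simps power2_eq_square)
  finally show "tr (\<lambda>x. M (M x)) \<le> G / (b - b') + tr P * (b - b') / (b * b'^2)" .
  have "tr P / (b * b') \<le> tr (\<lambda>x. R (M x))" using tRM nonneg le by simp
  from mult_left_mono[OF this, of "b - b'"] show "(b - b') * tr P / (b * b') \<le> G"
    using b' by (simp add: G)
qed

text \<open>The condition on \<open>w\<close> says that the rank one update pushes one further eigenvalue of \<open>A\<close> across the
  barrier; the last claim is the Sherman-Morrison formula.\<close>

lemma above_barrier_rank_one:
  assumes B: "above_barrier A P b" and b: "0 < b" and M: "resolvent A b M"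
    and w: "1 + w \<bullet> M w < 0"
  defines "q \<equiv> P w"
  shows "q \<noteq> 0"
    and "above_barrier (\<lambda>x. A x + (w \<bullet> x) *\<^sub>R w) (\<lambda>x. P x - ((q \<bullet> x) / (q \<bullet> q)) *\<^sub>R q) b"
    and "resolvent (\<lambda>x. A x + (w \<bullet> x) *\<^sub>R w) b
           (\<lambda>x. M x - ((M w \<bullet> x) / (1 + w \<bullet> M w)) *\<^sub>R M w)"
proof -
  have lA: "linear A" and lP: "linear P" and lM: "linear M"
    using B M by (auto simp: above_barrier_def self_adjoint_def resolvent_def)
  have sA: "A x \<bullet> y = x \<bullet> A y" and PP: "P (P x) = P x" and sP: "P x \<bullet> y = x \<bullet> P y" and PA: "P (A x) = 0" for x y
    using B by (auto simp: above_barrier_def self_adjoint_def)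
  have M1: "M (A x - b *\<^sub>R x) = x" and M2: "A (M x) - b *\<^sub>R M x = x" for x
    using M by (auto simp: resolvent_def)
  note PM = resolvent_properties[OF B b M]
  have sM: "M x \<bullet> y = x \<bullet> M y" for x y
    using PM(1) by (auto simp: self_adjoint_def)
  have AP: "A (P x) = 0" for x
  proof -
    have "A (P x) \<bullet> y = 0" for y by (simp add: sA sP PA)
    then show ?thesis by (metis inner_eq_zero_iff)
  qed
  show q0: "q \<noteq> 0" using PM(4)[of w] w by (auto simp: q_def)
  then have qq: "0 < q \<bullet> q" by simp
  have Pq: "P q = q" by (simp add: q_def PP)
  have Mq: "M q = - (1/b) *\<^sub>R q" using PM(3)[of w] by (simp add: q_def)
  have qx: "q \<bullet> x = q \<bullet> P x" for x using sP[of q x] Pq by simp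
  let ?A = "\<lambda>x. A x + (w \<bullet> x) *\<^sub>R w"
  let ?P = "\<lambda>x. P x - ((q \<bullet> x) / (q \<bullet> q)) *\<^sub>R q"
  \<comment> \<open>\<open>w\<close> splits into \<open>q\<close> in the range of \<open>P\<close>
    and \<open>p\<close> in its kernel, and \<open>w \<bullet> M w\<close> splits accordingly,
    without cross terms.\<close>
  define p where "p = w - q"
  have Pp: "P p = 0" using lP by (simp add: p_def linear_diff Pq) (simp add: q_def)
  have pq: "p \<bullet> q = 0" using sP[of p q] Pp Pq by simp
  define \<alpha> where "\<alpha> = p \<bullet> M p"
  have \<alpha>0: "0 \<le> \<alpha>" unfolding \<alpha>_def by (rule PM(4)) (rule Pp)
  have wMw: "w \<bullet> M w = \<alpha> - (q \<bullet> q) / b"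
  proof -
    have "w = p + q" by (simp add: p_def)
    moreover have "(p + q) \<bullet> M (p + q) = \<alpha> + p \<bullet> M q + q \<bullet> M p + q \<bullet> M q"
      using lM by (simp add: linear_add inner_add_left inner_add_right \<alpha>_def)
    moreover have "q \<bullet> M p = 0" using sM[of q p] pq by (simp add: Mq inner_commute)
    ultimately show ?thesis by (simp add: Mq pq)
  qed
  \<comment> \<open>The hypothesis on \<open>w\<close> in these terms; it supplies the strict
    inequality below when \<open>s \<noteq> 0\<close>.\<close>
  have big: "b * (1 + \<alpha>) < q \<bullet> q"
    using w b unfolding wMw by (simp add: field_simps)
  have form: "0 \<le> v \<bullet> A v - b * (v \<bullet> v)" if "P v = 0" for v
    using that B lA by (cases "v = 0") (auto simp: above_barrier_def intro: less_imp_le)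
  show "above_barrier ?A ?P b"
    unfolding above_barrier_def self_adjoint_def
  proof (intro conjI allI impI)
    show "linear ?A"
      by (intro linear_compose_add lA linearI) (auto simp: algebra_simps inner_add_right)
    show "linear ?P"
      by (intro linear_compose_sub lP linearI)
        (auto simp: algebra_simps inner_add_right add_divide_distrib)
    show "?A x \<bullet> y = x \<bullet> ?A y" for x y
      using sA[of x y] by (simp add: inner_add_left inner_add_right inner_commute[of x w])
    show "?P x \<bullet> y = x \<bullet> ?P y" for x y
      using sP[of x y] by (simp add: inner_diff_left inner_diff_right inner_commute[of x q])
    show "?P (?P x) = ?P x" for x
    proof -
      have "P (?P x) = ?P x" using lP by (simp add: linear_diff linear_cmul PP Pq)
      moreover have "q \<bullet> ?P x = 0" using q0 by (simp add: inner_diff_right qx[symmetric])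
      ultimately show ?thesis by simp
    qed
    show "?P (?A x) = 0" for x
    proof -
      have "P (?A x) = (w \<bullet> x) *\<^sub>R q" using lP by (simp add: linear_add linear_cmul PA q_def)
      moreover have "q \<bullet> ?A x = (w \<bullet> x) * (q \<bullet> q)"
        by (subst qx) (use calculation in simp)
      ultimately show ?thesis using q0 by simp
    qed
    fix x assume x: "?P x = 0" "x \<noteq> 0"
    \<comment> \<open>A vector killed by the new projection is a vector \<open>v\<close> killed by
      \<open>P\<close> plus a multiple of \<open>q\<close>, the direction that the update lifts out
      of the kernel.\<close>
    define s where "s = (q \<bullet> x) / (q \<bullet> q)"
    define v where "v = x - s *\<^sub>R q"
    have Pv: "P v = 0" using x lP by (simp add: v_def s_def linear_diff linear_cmul Pq)
    have vq: "v \<bullet> q = 0" using sP[of v q] Pv Pq by simp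
    have xe: "x = v + s *\<^sub>R q" by (simp add: v_def)
    have Aq: "A q = 0" by (simp add: q_def AP)
    define \<tau> where "\<tau> = s * (q \<bullet> q)"
    define u where "u = v \<bullet> p"
    have wx: "w \<bullet> x = u + \<tau>"
    proof -
      have "w = p + q" by (simp add: p_def)
      then show ?thesis using pq vq
        by (simp add: xe inner_add_left inner_add_right u_def \<tau>_def inner_commute)
    qed
    have xAx: "x \<bullet> A x = v \<bullet> A v"
    proof -
      have "A x = A v" using lA by (simp add: xe linear_add linear_cmul Aq)
      moreover have "q \<bullet> A v = 0" using sA[of q v] by (simp add: Aq)
      ultimately show ?thesis by (simp add: xe inner_add_left)
    qed
    have xx: "x \<bullet> x = v \<bullet> v + s * \<tau>"
      using vq by (simp add: xe inner_add_left inner_add_right \<tau>_def inner_commute)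
    \<comment> \<open>Nonnegativity of the form of \<open>A - b\<close> at \<open>y\<close> bounds
      the form at \<open>v\<close> from below, for every choice of \<open>r\<close>. This
      \<open>r\<close> leaves only a perfect square in \<open>u\<close>, which gives the best bound
      uniform in \<open>u\<close>.\<close>
    define r where "r = - \<tau> / (1 + \<alpha>)"
    define y where "y = v - r *\<^sub>R M p"
    have "P y = 0" using lP by (simp add: y_def linear_diff linear_cmul Pv PM(2) Pp)
    then have "0 \<le> y \<bullet> A y - b * (y \<bullet> y)" by (rule form)
    also have "\<dots> = y \<bullet> (A y - b *\<^sub>R y)" by (simp add: inner_diff_right)
    also have "A y - b *\<^sub>R y = (A v - b *\<^sub>R v) - r *\<^sub>R (A (M p) - b *\<^sub>R M p)"
      using lA by (simp add: y_def linear_diff linear_cmul algebra_simps)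
    also have "\<dots> = (A v - b *\<^sub>R v) - r *\<^sub>R p" by (simp add: M2)
    also have "y \<bullet> \<dots> = v \<bullet> (A v - b *\<^sub>R v) - r * u - r * (M p \<bullet> (A v - b *\<^sub>R v)) + r * r * \<alpha>"
      by (simp add: y_def inner_diff_left inner_diff_right u_def \<alpha>_def inner_commute algebra_simps)
    also have "M p \<bullet> (A v - b *\<^sub>R v) = u"
      by (simp add: sM M1 u_def inner_commute)
    finally have low: "2 * r * u - r * r * \<alpha> \<le> v \<bullet> A v - b * (v \<bullet> v)"
      by (simp add: inner_diff_right)
    have "\<tau>^2 / (1 + \<alpha>) \<le> 2 * r * u - r * r * \<alpha> + (u + \<tau>)^2"
    proof -
      have \<tau>r: "\<tau> = - r * (1 + \<alpha>)" using \<alpha>0 by (simp add: r_def)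
      then have "\<tau>^2 / (1 + \<alpha>) = r^2 * (1 + \<alpha>)" 
        using \<alpha>0 by (simp add: power2_eq_square)
      also have "\<dots> = 2 * r * u - r * r * \<alpha> + (u + \<tau>)^2 - (u + \<tau> + r)^2"
        unfolding \<tau>r by (simp add: power2_eq_square algebra_simps)
      finally show ?thesis by simp
    qed
    then have low2: "\<tau>^2 / (1 + \<alpha>) \<le> v \<bullet> A v - b * (v \<bullet> v) + (u + \<tau>)^2" using low by simp
    have goal: "x \<bullet> ?A x - b * (x \<bullet> x) = v \<bullet> A v - b * (v \<bullet> v) + (u + \<tau>)^2 - b * s * \<tau>"
    proof -
      have "x \<bullet> ?A x = v \<bullet> A v + (u + \<tau>)^2"
        using xAx wx by (simp add: inner_add_right power2_eq_square inner_commute)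
      then show ?thesis by (simp add: xx algebra_simps)
    qed
    have "0 < x \<bullet> ?A x - b * (x \<bullet> x)"
    proof (cases "s = 0")
      case True
      then have "v = x" by (simp add: v_def)
      then have "0 < v \<bullet> A v - b * (v \<bullet> v)" using B x(2) Pv by (auto simp: above_barrier_def)
      then show ?thesis unfolding goal using True by (simp add: \<tau>_def add_pos_nonneg)
    next
      case False
      have "b * s * \<tau> = b * (1 + \<alpha>) * (s^2 * (q \<bullet> q)) / (1 + \<alpha>)"
        using \<alpha>0 by (simp add: \<tau>_def power2_eq_square)
      also have "\<dots> < (q \<bullet> q) * (s^2 * (q \<bullet> q)) / (1 + \<alpha>)"
        using False qq \<alpha>0 big by (intro divide_strict_right_mono mult_strict_right_mono) auto
      also have "\<dots> = \<tau>^2 / (1 + \<alpha>)" by (simp add: \<tau>_def power2_eq_square)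
      finally show ?thesis using low2 unfolding goal by simp
    qed
    then show "b * (x \<bullet> x) < x \<bullet> ?A x" by simp
  qed
  let ?c = "1 + w \<bullet> M w"
  let ?M = "\<lambda>x. M x - ((M w \<bullet> x) / ?c) *\<^sub>R M w"
  have c0: "?c \<noteq> 0" using w by simp
  show "resolvent ?A b ?M"
    unfolding resolvent_def
  proof (intro conjI allI)
    show "linear ?M"
      by (intro linear_compose_sub lM linearI)
        (auto simp: algebra_simps inner_add_right add_divide_distrib)
    fix x
    have e: "?A x - b *\<^sub>R x = (A x - b *\<^sub>R x) + (w \<bullet> x) *\<^sub>R w" by simp
    have "M (?A x - b *\<^sub>R x) = x + (w \<bullet> x) *\<^sub>R M w"
      unfolding e using lM by (simp add: linear_add linear_cmul M1)
    moreover have "M w \<bullet> (?A x - b *\<^sub>R x) = (w \<bullet> x) * ?c"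
    proof -
      have "M w \<bullet> (A x - b *\<^sub>R x) = w \<bullet> x" by (simp only: sM M1)
      then show ?thesis
        unfolding e inner_add_right inner_scaleR_right
        by (simp add: inner_commute[of "M w"] algebra_simps)
    qed
    ultimately show "?M (?A x - b *\<^sub>R x) = x" using c0 by simp
    have "A (?M x) - b *\<^sub>R ?M x = (A (M x) - b *\<^sub>R M x) - ((M w \<bullet> x) / ?c) *\<^sub>R (A (M w) - b *\<^sub>R M w)"
      using lA by (simp add: linear_diff linear_cmul algebra_simps)
    also have "\<dots> = x - ((M w \<bullet> x) / ?c) *\<^sub>R w" by (simp add: M2)
    finally have "?A (?M x) - b *\<^sub>R ?M x = x + (w \<bullet> ?M x - (M w \<bullet> x) / ?c) *\<^sub>R w"
      by (simp add: algebra_simps)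
    moreover have "w \<bullet> ?M x = (M w \<bullet> x) / ?c"
      using c0 by (simp add: inner_diff_right sM field_simps)
    ultimately show "?A (?M x) - b *\<^sub>R ?M x = x" by simp
  qed
qed


text \<open>The barrier may be lowered from \<open>b\<close> to \<open>b'\<close> without increasing the potential \<open>tr R\<close>, provided
  that some \<open>w \<in> C\<close> satisfies \<open>w \<bullet> H w \<le> 0\<close> for the operator \<open>H = M\<^sup>2 + G M + G\<close>, where \<open>G\<close> is the
  drop of the potential.  The assumptions force \<open>tr H < 0\<close>.\<close>

lemma barrier_step:
  fixes C :: "'a::euclidean_space set"
  assumes B: "above_barrier A P b" and b': "0 < b'" "b' < b"
    and R: "resolvent A b R" and trR: "tr R \<le> - (1 / (b - b') + DIM('a))"
    and P: "b < (b - b') * tr P"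
    and unit: "\<And>w. w \<in> C \<Longrightarrow> norm w = 1"
    and John: "\<And>H. linear H \<Longrightarrow> tr H < 0 \<Longrightarrow> \<exists>w\<in>C. w \<bullet> H w \<le> 0"
  obtains w R' where "w \<in> C" "P w \<noteq> 0"
    "above_barrier (\<lambda>x. A x + (w \<bullet> x) *\<^sub>R w) (\<lambda>x. P x - ((P w \<bullet> x) / (P w \<bullet> P w)) *\<^sub>R P w) b'"
    "resolvent (\<lambda>x. A x + (w \<bullet> x) *\<^sub>R w) b' R'" "tr R' \<le> tr R"
proof -
  have b: "0 < b" using b' by simp
  have trP: "0 < tr P" using P b b' by (metis diff_gt_0_iff_gt less_trans zero_less_mult_pos)
  have B': "above_barrier A P b'" using above_barrier_mono[OF B] b' by simp
  obtain M where M: "resolvent A b' M" using resolvent_exists[OF B' b'(1)] by blast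
  then have lM: "linear M" by (simp add: resolvent_def)
  note PM = resolvent_properties[OF B' b'(1) M]
  have sM: "M x \<bullet> y = x \<bullet> M y" for x y
    using PM(1) by (auto simp: self_adjoint_def)
  define G where "G = tr R - tr M"
  note T = resolvent_traces[OF B b' R M, folded G_def]
  have "0 < (b - b') * tr P / (b * b')" using b b' trP by simp
  with T(2) have G0: "0 < G" by simp
  define H where "H x = M (M x) + G *\<^sub>R M x + G *\<^sub>R x" for x
  have lH: "linear H" unfolding H_def
    by (intro linear_compose_add linear_compose_scale_right linear_ident lM linear_compose[OF lM lM, unfolded o_def])
  \<comment> \<open>The assumption \<open>b < (b - b') * tr P\<close> makes the error term in the
    bound on \<open>tr (M M)\<close> smaller than \<open>G^2\<close>.\<close>
  have "tr P * (b - b') / (b * b'^2) < ((b - b') * tr P / (b * b'))^2"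
  proof -
    have "tr P * (b - b') / (b * b'^2) = b * ((b - b') * tr P) / (b * b')^2"
      using b b' by (simp add: field_simps power2_eq_square)
    also have "\<dots> < ((b - b') * tr P) * ((b - b') * tr P) / (b * b')^2"
      using P b b' trP by (intro divide_strict_right_mono mult_strict_right_mono) auto
    finally show ?thesis by (simp add: power2_eq_square)
  qed
  also have "\<dots> \<le> G^2" using T(2) b b' trP by (intro power_mono) auto
  finally have g2: "tr P * (b - b') / (b * b'^2) < G^2" .
  \<comment> \<open>Since \<open>G + tr M = tr R\<close>, the bound factors as \<open>G\<close>
    times \<open>tr R + 1 / (b - b') + DIM('a)\<close>, which is nonpositive by the assumption on
    \<open>tr R\<close>.\<close>
  have "tr H = tr (\<lambda>x. M (M x)) + G * (tr M + DIM('a))"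
    unfolding H_def by (simp add: tr_add tr_scaleR tr_ident algebra_simps)
  also have "\<dots> < G / (b - b') + G^2 + G * (tr M + DIM('a))"
    using T(1) g2 by simp
  also have "\<dots> = G * (tr R + 1 / (b - b') + DIM('a))"
    by (simp add: G_def power2_eq_square algebra_simps)
  also have "\<dots> \<le> 0" using trR G0 by (simp add: mult_le_0_iff)
  finally have "tr H < 0" .
  then obtain w where w: "w \<in> C" "w \<bullet> H w \<le> 0" using John[OF lH] by blast
  have ww: "w \<bullet> w = 1" using unit[OF w(1)] by (simp add: norm_eq_1)
  have "w \<noteq> 0" using ww by auto
  then have Mw: "0 < M w \<bullet> M w" using PM(5)[of w] by auto
  \<comment> \<open>As \<open>M w \<noteq> 0\<close> and \<open>G > 0\<close>, this yields the
    crossing condition \<open>1 + w \<bullet> M w < 0\<close>. Divided by that negative number, it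
    also shows that the rank one update raises the trace of \<open>M\<close> by at most
    \<open>G\<close>.\<close>
  have wH: "M w \<bullet> M w + G * (1 + w \<bullet> M w) \<le> 0"
    using w(2) ww by (simp add: H_def inner_add_right sM algebra_simps)
  have neg: "1 + w \<bullet> M w < 0"
  proof (rule ccontr)
    assume "\<not> ?thesis"
    then have "0 \<le> G * (1 + w \<bullet> M w)" using G0 by simp
    then show False using wH Mw by simp
  qed
  note N = above_barrier_rank_one[OF B' b'(1) M neg]
  let ?R = "\<lambda>x. M x - ((M w \<bullet> x) / (1 + w \<bullet> M w)) *\<^sub>R M w"
  have "?R = (\<lambda>x. M x - (1 / (1 + w \<bullet> M w)) *\<^sub>R (M w \<bullet> x) *\<^sub>R M w)" by simp
  then have "tr ?R = tr M - (M w \<bullet> M w) / (1 + w \<bullet> M w)"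
    by (simp only: tr_diff tr_scaleR tr_rank_one) simp
  also have "- ((M w \<bullet> M w) / (1 + w \<bullet> M w)) \<le> G"
    using wH neg by (simp add: field_simps)
  then have "tr M - (M w \<bullet> M w) / (1 + w \<bullet> M w) \<le> tr R" unfolding G_def by simp
  finally have "tr ?R \<le> tr R" .
  with that[OF w(1) N] show ?thesis by blast
qed

section \<open>Iterating the barrier step and extracting a well-conditioned subset\<close>

lemma above_barrier_kernel:
  assumes S: "finite S" and B: "above_barrier (\<lambda>x. \<Sum>w\<in>S. (w \<bullet> x) *\<^sub>R w) P b" and v: "v \<in> S"
  shows "P v = 0"
proof -
  let ?A = "\<lambda>x. \<Sum>w\<in>S. (w \<bullet> x) *\<^sub>R w"
  have PP: "P (P x) = P x" and sP: "P x \<bullet> y = x \<bullet> P y" and PA: "P (?A x) = 0" for x y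
    using B by (auto simp: above_barrier_def self_adjoint_def)
  \<comment> \<open>As \<open>P\<close> kills the range of \<open>?A\<close>, the quadratic form of
    \<open>?A\<close> vanishes at \<open>P v\<close>; being a sum of squares, it forces
    \<open>v \<bullet> P v = 0\<close>.\<close>
  have "?A (P v) \<bullet> P v = P v \<bullet> ?A (P v)" by (rule inner_commute)
  also have "\<dots> = v \<bullet> P (?A (P v))" by (rule sP)
  also have "\<dots> = 0" by (simp add: PA)
  finally have "(\<Sum>u\<in>S. (u \<bullet> P v)\<^sup>2) = 0"
    by (simp add: inner_sum_left power2_eq_square)
  then have "(v \<bullet> P v)\<^sup>2 = 0" using S v by (simp add: sum_nonneg_eq_0_iff)
  then have "P v \<bullet> P v = 0" using sP[of v "P v"] PP[of v] by simp
  then show ?thesis by simp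
qed

text \<open>The start is \<open>A = 0\<close>, \<open>P = id\<close> and barrier
  \<open>\<epsilon>\<close>, with potential \<open>- n / \<epsilon>\<close> for
  \<open>n = DIM('a)\<close>. The decrement \<open>\<delta>\<close> solves
  \<open>1 / \<delta> + n = n / \<epsilon>\<close>, exactly what \<open>barrier_step\<close> demands
  of the potential, and \<open>(1 - \<epsilon>)^2 * n\<close> decrements would bring the barrier
  down to \<open>\<epsilon>^2\<close>. Each step takes one dimension from \<open>P\<close>, whose
  trace enters the hypotheses of the next step.\<close>

lemma barrier_iteration:
  fixes C :: "'a::euclidean_space set" and \<epsilon> :: real
  assumes unit: "\<And>w. w \<in> C \<Longrightarrow> norm w = 1"
    and John: "\<And>H. linear H \<Longrightarrow> tr H < 0 \<Longrightarrow> \<exists>w\<in>C. w \<bullet> H w \<le> 0"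
    and \<epsilon>: "0 < \<epsilon>" "\<epsilon> < 1"
  defines "\<delta> \<equiv> \<epsilon> / (DIM('a) * (1 - \<epsilon>))"
  assumes k: "real k \<le> (1 - \<epsilon>)\<^sup>2 * DIM('a)"
  shows "\<exists>S P R. finite S \<and> card S = k \<and> S \<subseteq> C \<and> independent S \<and>
    above_barrier (\<lambda>x. \<Sum>w\<in>S. (w \<bullet> x) *\<^sub>R w) P (\<epsilon> - k * \<delta>) \<and> (\<forall>x. P x = 0 \<longrightarrow> x \<in> span S) \<and>
    tr P = DIM('a) - real k \<and>
    resolvent (\<lambda>x. \<Sum>w\<in>S. (w \<bullet> x) *\<^sub>R w) (\<epsilon> - k * \<delta>) R \<and> tr R \<le> - (DIM('a) / \<epsilon>)"
  using k
proof (induction k)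
  case 0
  have "above_barrier (\<lambda>x::'a. 0) (\<lambda>x. x) \<epsilon>"
    by (auto simp: above_barrier_def self_adjoint_def linear_zero linear_ident)
  moreover have "resolvent (\<lambda>x::'a. 0) \<epsilon> (\<lambda>x. (- (1 / \<epsilon>)) *\<^sub>R x)"
    using \<epsilon>(1) unfolding resolvent_def by (intro conjI linear_compose_scale_right linear_ident) auto
  moreover have "tr (\<lambda>x::'a. (- (1 / \<epsilon>)) *\<^sub>R x) = - (DIM('a) / \<epsilon>)"
    unfolding tr_scaleR tr_ident by simp
  ultimately show ?case
    by (intro exI[of _ "{}"] exI[of _ "\<lambda>x. x"] exI[of _ "\<lambda>x. (- (1 / \<epsilon>)) *\<^sub>R x"])
      (auto simp: tr_ident independent_empty)
next
  case (Suc k)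
  define n where "n = real DIM('a)"
  have n: "0 < n" by (simp add: n_def)
  have \<delta>: "\<delta> = \<epsilon> / (n * (1 - \<epsilon>))" by (simp add: \<delta>_def n_def)
  have \<delta>0: "0 < \<delta>" using \<epsilon> n by (simp add: \<delta>)
  have Sk: "real (Suc k) \<le> (1 - \<epsilon>)\<^sup>2 * n" using Suc.prems by (simp add: n_def)
  then obtain S P R where S: "finite S" "card S = k" "S \<subseteq> C" "independent S"
    and B: "above_barrier (\<lambda>x. \<Sum>w\<in>S. (w \<bullet> x) *\<^sub>R w) P (\<epsilon> - k * \<delta>)"
    and PS: "\<And>x. P x = 0 \<Longrightarrow> x \<in> span S"
    and trP: "tr P = n - real k"
    and R: "resolvent (\<lambda>x. \<Sum>w\<in>S. (w \<bullet> x) *\<^sub>R w) (\<epsilon> - k * \<delta>) R"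
    and trR: "tr R \<le> - (n / \<epsilon>)"
    using Suc.IH by (auto simp: n_def)
  let ?A = "\<lambda>x. \<Sum>w\<in>S. (w \<bullet> x) *\<^sub>R w"
  have lP: "linear P" using B by (auto simp: above_barrier_def self_adjoint_def)
  have b': "\<epsilon>\<^sup>2 \<le> \<epsilon> - Suc k * \<delta>"
  proof -
    have "Suc k * \<delta> \<le> ((1 - \<epsilon>)\<^sup>2 * n) * \<delta>" using Sk \<delta>0 by (intro mult_right_mono) auto
    also have "\<dots> = (1 - \<epsilon>) * \<epsilon>" using \<epsilon> n by (simp add: \<delta> power2_eq_square)
    finally show ?thesis by (simp add: power2_eq_square algebra_simps)
  qed
  have b'0: "0 < \<epsilon> - Suc k * \<delta>" by (rule less_le_trans[OF _ b']) (use \<epsilon> in simp)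
  have db: "(\<epsilon> - k * \<delta>) - (\<epsilon> - Suc k * \<delta>) = \<delta>" by (simp add: algebra_simps)
  have lt: "\<epsilon> - Suc k * \<delta> < \<epsilon> - k * \<delta>" using \<delta>0 by simp
  have c1: "tr R \<le> - (1 / ((\<epsilon> - k * \<delta>) - (\<epsilon> - Suc k * \<delta>)) + DIM('a))"
  proof -
    have "1 / \<delta> + n = n / \<epsilon>" using \<epsilon> n by (simp add: \<delta> field_simps)
    then show ?thesis using trR unfolding db n_def by simp
  qed
  \<comment> \<open>\<open>\<epsilon> < n * \<delta>\<close>, and the \<open>k * \<delta>\<close>
    already taken off the barrier matches the loss of \<open>k\<close> in
    \<open>tr P\<close>.\<close>
  have c2: "\<epsilon> - k * \<delta> < ((\<epsilon> - k * \<delta>) - (\<epsilon> - Suc k * \<delta>)) * tr P"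
  proof -
    have "\<epsilon> < n * \<delta>" using \<epsilon> n by (simp add: \<delta> field_simps)
    then show ?thesis unfolding db trP by (simp add: algebra_simps)
  qed
  obtain w R' where w: "w \<in> C" "P w \<noteq> 0"
    and B': "above_barrier (\<lambda>x. ?A x + (w \<bullet> x) *\<^sub>R w) (\<lambda>x. P x - ((P w \<bullet> x) / (P w \<bullet> P w)) *\<^sub>R P w) (\<epsilon> - Suc k * \<delta>)"
    and R': "resolvent (\<lambda>x. ?A x + (w \<bullet> x) *\<^sub>R w) (\<epsilon> - Suc k * \<delta>) R'" "tr R' \<le> tr R"
  proof (rule barrier_step[OF B b'0 lt R c1 c2, of C])
    show "norm w = 1" if "w \<in> C" for w using unit[OF that] .
    show "\<exists>w\<in>C. w \<bullet> H w \<le> 0" if "linear H" "tr H < 0" for H using John[OF that] .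
  qed (rule that)
  let ?P = "\<lambda>x. P x - ((P w \<bullet> x) / (P w \<bullet> P w)) *\<^sub>R P w"
  \<comment> \<open>\<open>P\<close> vanishes on the span of \<open>S\<close> but not at
    \<open>w\<close>, so \<open>w\<close> is new and independent of \<open>S\<close>.\<close>
  have P0: "P x = 0" if "x \<in> span S" for x
  proof -
    have "P v = 0" if v: "v \<in> S" for v
      using above_barrier_kernel[OF S(1) B v] .
    then show ?thesis using that lP by (metis linear_eq_0_on_span)
  qed
  have wS: "w \<notin> span S" using P0 w(2) by blast
  then have wS': "w \<notin> S" using span_base by blast
  have A': "(\<lambda>x. ?A x + (w \<bullet> x) *\<^sub>R w) = (\<lambda>x. \<Sum>v\<in>insert w S. (v \<bullet> x) *\<^sub>R v)"
    using S(1) wS' by (simp add: add.commute)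
  have "?P = (\<lambda>x. P x - (1 / (P w \<bullet> P w)) *\<^sub>R (P w \<bullet> x) *\<^sub>R P w)" by simp
  then have "tr ?P = tr P - 1" using w(2)
    by (simp only: tr_diff tr_scaleR tr_rank_one) simp
  moreover have "x \<in> span (insert w S)" if "?P x = 0" for x
  proof -
    have "P (x - ((P w \<bullet> x) / (P w \<bullet> P w)) *\<^sub>R w) = 0"
      using that lP by (simp add: linear_diff linear_cmul)
    then have "x - ((P w \<bullet> x) / (P w \<bullet> P w)) *\<^sub>R w \<in> span S" by (rule PS)
    then show ?thesis unfolding span_insert by blast
  qed
  moreover have "independent (insert w S)" using S(4) wS by (simp add: independent_insert)
  ultimately show ?case
    using S w(1) wS' B' R' trR trP unfolding A' n_def
    by (intro exI[of _ "insert w S"] exI[of _ ?P] exI[of _ R']) auto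
qed

text \<open>After \<open>k\<close> steps the barrier is still at least \<open>\<epsilon>^2\<close>,
  which bounds \<open>\<Sum>w\<in>S. (w \<bullet> x)^2\<close> from below on the kernel of
  \<open>P\<close>. The dual bound for linear combinations follows by writing their coefficients as
  \<open>a w = w \<bullet> y\<close> with \<open>y\<close> in that kernel.\<close>

theorem restricted_invertibility:
  fixes C :: "'a::euclidean_space set" and \<epsilon> :: real
  assumes unit: "\<And>w. w \<in> C \<Longrightarrow> norm w = 1"
    and John: "\<And>H. linear H \<Longrightarrow> tr H < 0 \<Longrightarrow> \<exists>w\<in>C. w \<bullet> H w \<le> 0"
    and \<epsilon>: "0 < \<epsilon>" "\<epsilon> < 1" and k: "real k \<le> (1 - \<epsilon>)\<^sup>2 * DIM('a)"
  obtains S where "finite S" "card S = k" "S \<subseteq> C" "independent S"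
    "\<And>a. \<epsilon>\<^sup>2 * (\<Sum>w\<in>S. (a w)\<^sup>2) \<le> (norm (\<Sum>w\<in>S. a w *\<^sub>R w))\<^sup>2"
proof -
  define \<delta> where "\<delta> = \<epsilon> / (DIM('a) * (1 - \<epsilon>))"
  obtain S P where S: "finite S" "card S = k" "S \<subseteq> C" "independent S"
    and B: "above_barrier (\<lambda>x. \<Sum>w\<in>S. (w \<bullet> x) *\<^sub>R w) P (\<epsilon> - k * \<delta>)"
    using barrier_iteration[OF unit John \<epsilon> k] unfolding \<delta>_def by blast
  let ?A = "\<lambda>x. \<Sum>w\<in>S. (w \<bullet> x) *\<^sub>R w"
  have b: "\<epsilon>\<^sup>2 \<le> \<epsilon> - k * \<delta>"
  proof -
    have "k * \<delta> \<le> ((1 - \<epsilon>)\<^sup>2 * DIM('a)) * \<delta>" 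
      using k \<epsilon> by (intro mult_right_mono) (auto simp: \<delta>_def)
    also have "\<dots> = (1 - \<epsilon>) * \<epsilon>" using \<epsilon> by (simp add: \<delta>_def power2_eq_square)
    finally show ?thesis by (simp add: power2_eq_square algebra_simps)
  qed
  have B: "above_barrier ?A P (\<epsilon>\<^sup>2)" using above_barrier_mono[OF B b] .
  have lA: "linear ?A" and lP: "linear P"
    using B by (auto simp: above_barrier_def self_adjoint_def)
  have PP: "P (P x) = P x" and PA: "P (?A x) = 0" 
    and pos: "P x = 0 \<Longrightarrow> \<epsilon>\<^sup>2 * (x \<bullet> x) \<le> x \<bullet> ?A x" for x
    using B lA by (auto simp: above_barrier_def self_adjoint_def)
  have xA: "x \<bullet> ?A x = (\<Sum>w\<in>S. (w \<bullet> x)\<^sup>2)" for x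
    by (simp add: inner_sum_right power2_eq_square inner_commute)
  \<comment> \<open>Adding \<open>P\<close> fills the kernel of \<open>?A\<close>; the sum is
    invertible, so every linear combination of \<open>S\<close> is a value of
    \<open>?N\<close>.\<close>
  let ?N = "\<lambda>x. ?A x + P x"
  have lN: "linear ?N" by (intro linear_compose_add lA lP)
  have "x = 0" if "?N x = 0" for x
  proof -
    have "P (?N x) = P x" using lP by (simp add: linear_add PA PP)
    then have Px: "P x = 0" using that lP by (simp add: linear_0)
    then have "?A x = 0" using that by simp
    then have "x \<bullet> ?A x = 0" by (simp only: inner_zero_right)
    then have "\<epsilon>\<^sup>2 * (x \<bullet> x) \<le> 0" using pos[OF Px] by simp
    then have "x \<bullet> x \<le> 0" using \<epsilon> by (simp add: mult_le_0_iff power2_eq_square)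
    then show ?thesis by (metis inner_eq_zero_iff inner_ge_zero order_antisym)
  qed
  then have "inj ?N" using linear_injective_0[OF lN] by blast
  then have surj: "surj ?N" using linear_injective_imp_surjective[OF lN] by simp
  have "\<epsilon>\<^sup>2 * (\<Sum>w\<in>S. (a w)\<^sup>2) \<le> (norm (\<Sum>w\<in>S. a w *\<^sub>R w))\<^sup>2" for a
  proof -
    let ?x = "\<Sum>w\<in>S. a w *\<^sub>R w"
    obtain y where y: "?x = ?N y" using surj by (meson surjD)
    have "P ?x = P y" unfolding y using lP by (simp add: linear_add PA PP)
    moreover have "P w = 0" if "w \<in> S" for w
      using above_barrier_kernel[OF S(1) B that] .
    ultimately have Py: "P y = 0" using lP by (simp add: linear_sum linear_cmul)
    then have x: "?x = ?A y" using y by simp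
    \<comment> \<open>Independence of \<open>S\<close> identifies the coefficients.\<close>
    then have "(\<Sum>w\<in>S. (a w - w \<bullet> y) *\<^sub>R w) = 0"
      by (simp add: scaleR_diff_left sum_subtractf)
    then have a: "a w = w \<bullet> y" if "w \<in> S" for w
      using independentD[OF S(4,1) order_refl, of "\<lambda>w. a w - w \<bullet> y"] that by force
    define s where "s = (\<Sum>w\<in>S. (a w)\<^sup>2)"
    have s: "y \<bullet> ?A y = s" unfolding xA s_def using a by simp
    have "\<epsilon>\<^sup>2 * s \<le> (norm (?A y))\<^sup>2"
    proof (cases "s = 0")
      case False
      then have s0: "0 < s" by (simp add: s_def sum_nonneg less_le)
      \<comment> \<open>Cauchy-Schwarz for \<open>y\<close> and \<open>?A y\<close>, together with
        the barrier bound \<open>\<epsilon>^2 * (y \<bullet> y) \<le> s\<close>.\<close>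
      have "\<epsilon>\<^sup>2 * s * s = \<epsilon>\<^sup>2 * (y \<bullet> ?A y)\<^sup>2" by (simp add: s power2_eq_square)
      also have "\<dots> \<le> \<epsilon>\<^sup>2 * ((y \<bullet> y) * (?A y \<bullet> ?A y))"
        by (intro mult_left_mono Cauchy_Schwarz_ineq) simp
      also have "\<dots> \<le> s * (norm (?A y))\<^sup>2"
        using mult_right_mono[OF pos[OF Py], of "?A y \<bullet> ?A y"]
        by (simp add: s power2_norm_eq_inner mult.assoc del: inner_sum_left inner_sum_right)
      finally show ?thesis using s0 by (simp add: mult.commute[of s])
    qed simp
    then show ?thesis unfolding x s_def .
  qed
  with that S show ?thesis by blast
qed

section \<open>Norms and John's position\<close>

lemma is_norm_props:
  assumes "is_norm N"
  shows "N x = 0 \<longleftrightarrow> x = 0" "N (x + y) \<le> N x + N y" "N (c *\<^sub>R x) = \<bar>c\<bar> * N x"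
    "N 0 = 0" "N (- x) = N x" "0 \<le> N x" "x \<noteq> 0 \<Longrightarrow> 0 < N x" "\<bar>N x - N y\<bar> \<le> N (x - y)"
proof -
  show *: "N x = 0 \<longleftrightarrow> x = 0" "N (x + y) \<le> N x + N y" "N (c *\<^sub>R x) = \<bar>c\<bar> * N x" for x y c
    using assms by (auto simp: is_norm_def)
  show z: "N 0 = 0" using * by blast
  show m: "N (- x) = N x" for x using *(3)[of "-1" x] by simp
  show n: "0 \<le> N x" for x using *(2)[of x "- x"] z m[of x] by simp
  show "x \<noteq> 0 \<Longrightarrow> 0 < N x" using *(1)[of x] n[of x] by linarith
  have "N x \<le> N (x - y) + N y" for x y using *(2)[of "x - y" y] by simp
  from this[of x y] this[of y x] m[of "x - y"] show "\<bar>N x - N y\<bar> \<le> N (x - y)" by simp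
qed

lemma is_norm_sum:
  assumes "is_norm N" shows "N (\<Sum>i\<in>I. f i) \<le> (\<Sum>i\<in>I. N (f i))"
proof (induction I rule: infinite_finite_induct)
  case (insert i I)
  then show ?case using is_norm_props(2)[OF assms, of "f i" "sum f I"] by simp
qed (simp_all add: is_norm_props[OF assms])

lemma is_norm_upper:
  fixes N :: "'a::euclidean_space \<Rightarrow> real"
  assumes "is_norm N"
  obtains L where "0 < L" "\<And>x. N x \<le> L * norm x"
proof -
  define L where "L = (\<Sum>b\<in>Basis. N b) + 1"
  have L: "0 < L" unfolding L_def by (intro add_nonneg_pos sum_nonneg is_norm_props[OF assms]) auto
  have "N x \<le> L * norm x" for x
  proof -
    have "N x = N (\<Sum>b\<in>Basis. (x \<bullet> b) *\<^sub>R b)" by (simp add: euclidean_representation)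
    also have "\<dots> \<le> (\<Sum>b\<in>Basis. \<bar>x \<bullet> b\<bar> * N b)"
      using is_norm_sum[OF assms, of "\<lambda>b. (x \<bullet> b) *\<^sub>R b" Basis] by (simp add: is_norm_props[OF assms])
    also have "\<dots> \<le> (\<Sum>b\<in>Basis. norm x * N b)"
      by (intro sum_mono mult_right_mono is_norm_props[OF assms] Basis_le_norm)
    also have "\<dots> = norm x * (\<Sum>b\<in>Basis. N b)" by (rule sum_distrib_left[symmetric])
    also have "\<dots> \<le> L * norm x" by (simp add: L_def algebra_simps)
    finally show ?thesis .
  qed
  with L that show thesis by blast
qed

lemma is_norm_continuous_on:
  fixes N :: "'a::euclidean_space \<Rightarrow> real"
  assumes "is_norm N" shows "continuous_on S N"
proof -
  obtain L where L: "0 < L" "\<And>x. N x \<le> L * norm x" using is_norm_upper[OF assms] by blast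
  have "L-lipschitz_on S N"
  proof (rule lipschitz_onI)
    show "dist (N x) (N y) \<le> L * dist x y" for x y
      using is_norm_props(8)[OF assms, of x y] L(2)[of "x - y"] by (simp add: dist_real_def dist_norm)
  qed (use L in simp)
  then show ?thesis by (rule lipschitz_on_continuous_on)
qed

lemma is_norm_lower:
  fixes N :: "'a::euclidean_space \<Rightarrow> real"
  assumes "is_norm N"
  obtains c where "0 < c" "\<And>x. c * norm x \<le> N x"
proof -
  have "sphere (0::'a) 1 \<noteq> {}" by simp
  then obtain u where u: "norm u = 1" "\<And>x. norm x = 1 \<Longrightarrow> N u \<le> N x"
    using continuous_attains_inf[OF compact_sphere _ is_norm_continuous_on[OF assms], of 0 1] by auto
  have "N u * norm x \<le> N x" for x
  proof (cases "x = 0")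
    case False
    have "N u \<le> N ((1 / norm x) *\<^sub>R x)" by (rule u(2)) (use False in simp)
    then show ?thesis using False by (simp add: is_norm_props[OF assms] field_simps)
  qed (simp add: is_norm_props[OF assms])
  moreover have "u \<noteq> 0" using u(1) by (metis norm_zero zero_neq_one)
  then have "0 < N u" by (rule is_norm_props(7)[OF assms])
  ultimately show thesis using that by blast
qed

lemma is_norm_comp:
  assumes "is_norm N" "linear U" "inj U" shows "is_norm (\<lambda>x. N (U x))"
proof -
  have "U x = 0 \<longleftrightarrow> x = 0" for x
    using assms(2,3) by (metis linear_0 injD)
  then show ?thesis using assms(1,2) unfolding is_norm_def
    by (simp add: linear_add linear_cmul)
qed

text \<open>Hahn-Banach: a hyperplane separates \<open>y\<close> from the open ball
  \<open>N x < N y\<close>. Its normal, rescaled to take the value \<open>N y\<close> at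
  \<open>y\<close>, is dominated by \<open>N\<close> by homogeneity.\<close>

lemma norming_functional:
  fixes N :: "'a::euclidean_space \<Rightarrow> real"
  assumes N: "is_norm N"
  obtains z where "\<And>x. z \<bullet> x \<le> N x" "z \<bullet> y = N y"
proof (cases "y = 0")
  case True
  show thesis by (rule that[of 0]) (simp_all add: True is_norm_props[OF N])
next
  case False
  then have Ny: "0 < N y" by (rule is_norm_props(7)[OF N])
  have "convex {x. N x < N y}"
  proof (rule convexI, safe)
    fix x1 x2 :: 'a and u v :: real
    assume a: "N x1 < N y" "N x2 < N y" "0 \<le> u" "0 \<le> v" "u + v = 1"
    have "N (u *\<^sub>R x1 + v *\<^sub>R x2) \<le> u * N x1 + v * N x2"
      using is_norm_props(2)[OF N, of "u *\<^sub>R x1" "v *\<^sub>R x2"] a by (simp add: is_norm_props[OF N])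
    also have "\<dots> < N y" by (rule convex_bound_lt[OF a])
    finally show "N (u *\<^sub>R x1 + v *\<^sub>R x2) < N y" .
  qed
  moreover have "0 \<in> {x. N x < N y}" using Ny by (simp add: is_norm_props[OF N])
  then have "{x. N x < N y} \<noteq> {}" by blast
  ultimately obtain a b where a: "a \<noteq> 0" "\<And>x. N x < N y \<Longrightarrow> a \<bullet> x \<le> b" "b \<le> a \<bullet> y"
    using separating_hyperplane_sets[of "{x. N x < N y}" "{y}"] by auto
  have ay: "a \<bullet> x \<le> a \<bullet> y" if "N x < N y" for x using a that by force
  \<comment> \<open>A number \<open>s\<close> strictly above \<open>N x\<close> brings the rescaled
    \<open>x\<close> into the open ball, also for \<open>x = 0\<close>; later \<open>s\<close>
    decreases to \<open>N x\<close>.\<close>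
  have scaled: "N y * (a \<bullet> x) \<le> s * (a \<bullet> y)" if s: "N x < s" for x s
  proof -
    have s0: "0 < s" using s is_norm_props(6)[OF N, of x] by simp
    have "N ((N y / s) *\<^sub>R x) = N y * (N x / s)"
      using s0 Ny by (simp add: is_norm_props(3)[OF N])
    also have "\<dots> < N y * 1" using s s0 Ny by (intro mult_strict_left_mono) auto
    finally have "N ((N y / s) *\<^sub>R x) < N y" by simp
    from ay[OF this] have "s * ((N y / s) * (a \<bullet> x)) \<le> s * (a \<bullet> y)"
      using s0 by (intro mult_left_mono) auto
    then show ?thesis using s0 by simp
  qed
  have "0 < a \<bullet> y"
  proof -
    have "0 < N y * (a \<bullet> a)" using Ny a(1) by simp
    also have "\<dots> \<le> (N a + 1) * (a \<bullet> y)" by (rule scaled) simp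
    finally show ?thesis using is_norm_props(6)[OF N, of a]
      by (simp add: zero_less_mult_iff)
  qed
  have "N y / (a \<bullet> y) * (a \<bullet> x) \<le> N x" for x
  proof (rule dense_ge)
    fix s assume "N x < s"
    then have "N y * (a \<bullet> x) / (a \<bullet> y) \<le> s"
      using scaled \<open>0 < a \<bullet> y\<close> by (simp only: pos_divide_le_eq)
    then show "N y / (a \<bullet> y) * (a \<bullet> x) \<le> s" by simp
  qed
  then show thesis using \<open>0 < a \<bullet> y\<close> by (intro that[of "(N y / (a \<bullet> y)) *\<^sub>R a"]) auto
qed

section \<open>John's position by maximising the determinant\<close>

lemma det_derivative:
  fixes H :: "real^'n^'n"
  shows "((\<lambda>t. det (mat 1 - t *\<^sub>R H)) has_real_derivative - trace H) (at 0)"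
proof -
  define D where "D p = (\<Sum>k\<in>UNIV. - (H$k$(p k)) * (\<Prod>j\<in>UNIV - {k}. (mat 1 :: real^'n^'n)$j$(p j)))" for p
  have der: "((\<lambda>t. \<Prod>i\<in>UNIV. (mat 1 - t *\<^sub>R H)$i$(p i)) has_real_derivative D p) (at 0)" for p
  proof -
    have "((\<lambda>t. \<Prod>i\<in>UNIV. (mat 1 - t *\<^sub>R H)$i$(p i)) has_real_derivative
       (\<Sum>k\<in>UNIV. - (H$k$(p k)) * (\<Prod>j\<in>UNIV - {k}. (mat 1 - 0 *\<^sub>R H)$j$(p j)))) (at 0)"
      by (intro has_field_derivative_prod) (auto intro!: derivative_eq_intros)
    then show ?thesis by (simp add: D_def)
  qed
  have "((\<lambda>t. det (mat 1 - t *\<^sub>R H)) has_real_derivative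
      (\<Sum>p\<in>{p. p permutes (UNIV::'n set)}. of_int (sign p) * D p)) (at 0)"
    unfolding det_def by (intro DERIV_sum DERIV_cmult der)
  also have "(\<Sum>p\<in>{p. p permutes (UNIV::'n set)}. of_int (sign p) * D p) =
      (\<Sum>p\<in>{id}. of_int (sign p) * D p)"
  proof (rule sum.mono_neutral_right)
    show "finite {p. p permutes (UNIV::'n set)}" by (simp add: finite_permutations)
    show "{id} \<subseteq> {p. p permutes (UNIV::'n set)}" by (simp add: permutes_id)
    show "\<forall>p\<in>{p. p permutes (UNIV::'n set)} - {id}. real_of_int (sign p) * D p = 0"
    proof
      \<comment> \<open>A permutation other than the identity moves both \<open>i\<close> and
        \<open>p i\<close>, so after one factor is differentiated an off-diagonal zero of the
        identity matrix remains.\<close>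
      fix p assume p: "p \<in> {p. p permutes (UNIV::'n set)} - {id}"
      then obtain i where i: "p i \<noteq> i" by (auto simp: fun_eq_iff)
      have "inj p" using p by (auto simp: permutes_inj)
      then have pi: "p (p i) \<noteq> p i" using i by (auto dest: injD)
      have z: "(\<Prod>j\<in>UNIV - {k}. (mat 1 :: real^'n^'n)$j$(p j)) = 0" for k
      proof (rule prod_zero)
        show "\<exists>j\<in>UNIV - {k}. (mat 1 :: real^'n^'n)$j$(p j) = 0"
        proof (cases "k = i")
          case True
          then show ?thesis using pi i by (intro bexI[of _ "p i"]) (auto simp: mat_def)
        next
          case False
          then show ?thesis using i by (intro bexI[of _ i]) (auto simp: mat_def)
        qed
      qed simp
      show "real_of_int (sign p) * D p = 0" unfolding D_def z by simp
    qed
  qed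
  also have "\<dots> = - trace H" by (simp add: D_def trace_def mat_def sum_negf)
  finally show ?thesis .
qed

lemma tr_eq_trace:
  fixes H :: "real^'n \<Rightarrow> real^'n"
  shows "tr H = trace (matrix H)"
proof -
  have B: "(Basis :: (real^'n) set) = range (\<lambda>i. axis i 1)" by (auto simp: Basis_vec_def)
  have "inj (\<lambda>i::'n. axis i (1::real))" by (auto simp: inj_on_def axis_eq_axis)
  then show ?thesis unfolding tr_def trace_def B
    by (simp add: sum.reindex matrix_def inner_axis')
qed

text \<open>Otherwise \<open>1 - t H\<close> would, for small \<open>t > 0\<close>, still be a contraction from \<open>N\<close> to the Euclidean norm,
  with determinant greater than \<open>1\<close>.\<close>

lemma contact_point:
  fixes N :: "real^'n \<Rightarrow> real"
  assumes N: "is_norm N" and ge: "\<And>x. norm x \<le> N x"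
    and max: "\<And>S::real^'n^'n. (\<And>x. norm (S *v x) \<le> N x) \<Longrightarrow> det S \<le> 1"
    and H: "linear H" "tr H < 0"
  shows "\<exists>w. norm w = 1 \<and> N w = 1 \<and> w \<bullet> H w \<le> 0"
proof (rule ccontr)
  assume "\<not> ?thesis"
  then have pos: "0 < w \<bullet> H w" if "norm w = 1" "N w = 1" for w using that by force
  have cH: "continuous_on A H" for A using H(1) by (simp add: linear_continuous_on linear_linear)
  let ?g = "\<lambda>x. max (x \<bullet> H x) (N x - 1)"
  have "sphere (0::real^'n) 1 \<noteq> {}" by simp
  moreover have "continuous_on (sphere 0 1) ?g"
    by (intro continuous_intros cH is_norm_continuous_on[OF N])
  ultimately obtain u where u: "norm u = 1" "\<And>x. norm x = 1 \<Longrightarrow> ?g u \<le> ?g x"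
    using continuous_attains_inf[OF compact_sphere, of 0 1 ?g] by auto
  \<comment> \<open>A uniform dichotomy by compactness: each unit vector has
    \<open>x \<bullet> H x \<ge> \<eta>\<close> or \<open>N x \<ge> 1 + \<eta>\<close>. Here
    \<open>\<eta>\<close> is positive because \<open>x \<bullet> H x\<close> is positive at contact
    points and \<open>N\<close> exceeds \<open>1\<close> at all other unit vectors.\<close>
  define \<eta> where "\<eta> = ?g u"
  have \<eta>: "0 < \<eta>"
  proof (cases "N u = 1")
    case True
    then show ?thesis using pos[OF u(1)] by (simp add: \<eta>_def less_max_iff_disj)
  next
    case False
    then show ?thesis using ge[of u] u(1) by (simp add: \<eta>_def less_max_iff_disj)
  qed
  obtain L where L: "0 < L" "\<And>x. norm (H x) \<le> L * norm x"
    using linear_bounded_pos[OF H(1)] by blast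
  have contr: "norm (x - t *\<^sub>R H x) \<le> N x"
    if t: "0 < t" "t \<le> \<eta> / L" "t \<le> 2 * \<eta> / L^2" and x: "norm x = 1" for t x
  proof -
    \<comment> \<open>In the first case the first-order decrease outweighs \<open>t^2 * L^2\<close>;
      in the second the slack \<open>N x - 1\<close> absorbs the perturbation.\<close>
    consider "\<eta> \<le> x \<bullet> H x" | "\<eta> \<le> N x - 1"
      using u(2)[OF x] unfolding \<eta>_def by linarith
    then show ?thesis
    proof cases
      case 1
      have "(norm (x - t *\<^sub>R H x))\<^sup>2 = 1 - 2 * t * (x \<bullet> H x) + t^2 * (norm (H x))\<^sup>2"
        using x unfolding power2_norm_eq_inner norm_eq_1
        by (simp add: inner_diff_left inner_diff_right inner_commute[of "H x" x]
            power2_eq_square algebra_simps)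
      also have "\<dots> \<le> 1 - 2 * t * \<eta> + t^2 * L^2"
        using 1 t L(2)[of x] x by (intro add_mono diff_mono mult_left_mono power_mono) auto
      also have "\<dots> = 1 - t * (2 * \<eta> - t * L^2)" by (simp add: power2_eq_square algebra_simps)
      also have "\<dots> \<le> 1" using t L(1) by (simp add: field_simps)
      finally have "norm (x - t *\<^sub>R H x) \<le> 1"
        using power2_le_imp_le[of "norm (x - t *\<^sub>R H x)" 1] by simp
      then show ?thesis using ge[of x] x by simp
    next
      case 2
      have "norm (x - t *\<^sub>R H x) \<le> 1 + t * norm (H x)"
        using norm_triangle_ineq4[of x "t *\<^sub>R H x"] x t by simp
      also have "\<dots> \<le> 1 + t * L" using L(2)[of x] x t by simp
      also have "\<dots> \<le> 1 + \<eta>" using t L(1) by (simp add: field_simps)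
      finally show ?thesis using 2 by simp
    qed
  qed
  have "0 < - trace (matrix H)" using H(2) by (simp add: tr_eq_trace)
  from DERIV_pos_inc_right[OF det_derivative this]
  obtain d where d: "0 < d" "\<And>t. 0 < t \<Longrightarrow> t < d \<Longrightarrow> 1 < det (mat 1 - t *\<^sub>R matrix H)"
    by auto
  define t where "t = min (d/2) (min (\<eta> / L) (2 * \<eta> / L^2))"
  have t: "0 < t" "t < d" "t \<le> \<eta> / L" "t \<le> 2 * \<eta> / L^2"
    using d(1) \<eta> L(1) by (auto simp: t_def min_less_iff_disj min_le_iff_disj)
  have "norm ((mat 1 - t *\<^sub>R matrix H) *v x) \<le> N x" for x
  proof (cases "x = 0")
    case False
    let ?y = "(1 / norm x) *\<^sub>R x"
    have "norm ?y = 1" using False by simp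
    then have "norm (?y - t *\<^sub>R H ?y) \<le> N ?y" by (intro contr t)
    moreover have "?y - t *\<^sub>R H ?y = (1 / norm x) *\<^sub>R (x - t *\<^sub>R H x)"
      using H(1) by (simp add: linear_cmul algebra_simps)
    ultimately have "(1 / norm x) * norm (x - t *\<^sub>R H x) \<le> (1 / norm x) * N x"
      by (simp add: is_norm_props(3)[OF N])
    then have "norm (x - t *\<^sub>R H x) \<le> N x" using False by (simp add: divide_le_cancel)
    then show ?thesis using H(1)
      by (simp add: matrix_vector_mult_diff_rdistrib scaleR_matrix_vector_assoc[symmetric] matrix_works)
  qed (simp add: is_norm_props[OF N])
  then have "det (mat 1 - t *\<^sub>R matrix H) \<le> 1" by (rule max)
  with d(2)[OF t(1,2)] show False by simp
qed

text \<open>By compactness some \<open>T\<close> has maximal determinant among the matrices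
  contracting \<open>N\<close> to the Euclidean norm. The ellipsoid
  \<open>norm (T *v x) \<le> 1\<close> then has least volume around the unit ball of
  \<open>N\<close>, and \<open>U\<close> is the inverse of \<open>T\<close>.\<close>

lemma exists_extremal_position:
  fixes N :: "real^'n \<Rightarrow> real"
  assumes N: "is_norm N"
  obtains U :: "real^'n \<Rightarrow> real^'n" where "linear U" "bij U" "\<And>x. norm x \<le> N (U x)"
    "\<And>S::real^'n^'n. (\<And>x. norm (S *v x) \<le> N (U x)) \<Longrightarrow> det S \<le> 1"
proof -
  let ?K = "{T::real^'n^'n. \<forall>x. norm (T *v x) \<le> N x}"
  obtain c where c: "0 < c" "\<And>x. c * norm x \<le> N x" using is_norm_lower[OF N] by blast
  have lin: "linear (\<lambda>T::real^'n^'n. T *v x)" for x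
    by (intro linearI) (simp_all add: matrix_vector_mult_add_rdistrib scaleR_matrix_vector_assoc)
  have "closed ?K"
  proof -
    have "?K = (\<Inter>x. {T::real^'n^'n. norm (T *v x) \<le> N x})" by auto
    moreover have "closed {T::real^'n^'n. norm (T *v x) \<le> N x}" for x
      using lin[of x]
      by (intro closed_Collect_le continuous_on_norm continuous_on_const)
        (simp add: linear_continuous_on linear_linear)
    ultimately show ?thesis by auto
  qed
  moreover have "bounded ?K"
  proof -
    have "norm T \<le> (\<Sum>i\<in>(UNIV::'n set). \<Sum>j\<in>(UNIV::'n set). N (axis j 1))" if T: "T \<in> ?K" for T
    proof -
      have e: "\<bar>T$i$j\<bar> \<le> N (axis j 1)" for i j
      proof -
        have "T$i$j = (T *v axis j 1) $ i" by (simp add: matrix_vector_mult_basis column_def)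
        also have "\<bar>\<dots>\<bar> \<le> norm (T *v axis j 1)" by (rule component_le_norm_cart)
        also have "\<dots> \<le> N (axis j 1)" using T by blast
        finally show ?thesis .
      qed
      have "norm T \<le> (\<Sum>i\<in>UNIV. norm (T$i))" unfolding norm_vec_def by (rule L2_set_le_sum) simp
      also have "\<dots> \<le> (\<Sum>i\<in>UNIV. \<Sum>j\<in>UNIV. \<bar>T$i$j\<bar>)" by (intro sum_mono norm_le_l1_cart)
      also have "\<dots> \<le> (\<Sum>i\<in>(UNIV::'n set). \<Sum>j\<in>(UNIV::'n set). N (axis j 1))"
        by (intro sum_mono e)
      finally show ?thesis .
    qed
    then show ?thesis unfolding bounded_iff by blast
  qed
  ultimately have "compact ?K" by (simp add: compact_eq_bounded_closed)
  \<comment> \<open>A small multiple of the identity is admissible: the set is nonempty and the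
    maximal determinant positive.\<close>
  moreover have cK: "c *\<^sub>R mat 1 \<in> ?K"
    using c by (simp add: scaleR_matrix_vector_assoc[symmetric])
  then have "?K \<noteq> {}" by blast
  moreover have "continuous_on ?K det" unfolding det_def by (intro continuous_intros)
  ultimately obtain T where T: "T \<in> ?K" "\<And>S. S \<in> ?K \<Longrightarrow> det S \<le> det T"
    using continuous_attains_sup[of ?K det] by blast
  have "0 < c ^ CARD('n)" using c by simp
  also have "\<dots> = det (c *\<^sub>R mat 1 :: real^'n^'n)"
    by (subst det_diagonal) (auto simp: mat_def)
  also have "\<dots> \<le> det T" using T(2)[OF cK] .
  finally have dT: "0 < det T" .
  then obtain T' where T': "T ** T' = mat 1" "T' ** T = mat 1"
    using invertible_det_nz[of T] by (auto simp: invertible_def)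
  have b: "T *v (T' *v x) = x" "T' *v (T *v x) = x" for x
    using T' by (simp_all add: matrix_vector_mul_assoc)
  show thesis
  proof (rule that[of "\<lambda>x. T' *v x"])
    show "bij ((*v) T')" by (rule o_bij[of "(*v) T"]) (auto simp: b fun_eq_iff)
    show "norm x \<le> N (T' *v x)" for x
    proof -
      have "norm (T *v (T' *v x)) \<le> N (T' *v x)" using T(1) by blast
      then show ?thesis by (simp add: b)
    qed
    fix S :: "real^'n^'n" assume S: "\<And>x. norm (S *v x) \<le> N (T' *v x)"
    \<comment> \<open>A competitor \<open>S\<close> in the new position becomes
      \<open>S ** T\<close> in the old one, and determinants multiply.\<close>
    have "norm ((S ** T) *v x) \<le> N x" for x
      using S[of "T *v x"] by (simp add: matrix_vector_mul_assoc[symmetric] b)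
    then have "S ** T \<in> ?K" by simp
    then have "det S * det T \<le> 1 * det T" using T(2)[of "S ** T"] by (simp add: det_mul)
    then show "det S \<le> 1" using dT by (simp only: mult_le_cancel_right)
  qed simp
qed

text \<open>If \<open>z\<close> is a functional of dual norm \<open>1\<close> and \<open>|z|\<^sup>2 > \<alpha> n > n\<close>, then \<open>H = \<alpha> - z z\<^sup>T\<close> violates John's
  condition.\<close>

lemma contact_point_upper:
  fixes N :: "'a::euclidean_space \<Rightarrow> real"
  assumes N: "is_norm N"
    and John: "\<And>H. linear H \<Longrightarrow> tr H < 0 \<Longrightarrow> \<exists>w. norm w = 1 \<and> N w = 1 \<and> w \<bullet> H w \<le> 0"
  shows "N y \<le> sqrt DIM('a) * norm y"
proof (rule ccontr)
  assume "\<not> ?thesis"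
  then have less: "sqrt DIM('a) * norm y < N y" by simp
  obtain z where z: "\<And>x. z \<bullet> x \<le> N x" "z \<bullet> y = N y" using norming_functional[OF N, of y] by metis
  have "sqrt DIM('a) * norm y < norm z * norm y"
    using less z(2) norm_cauchy_schwarz[of z y] by simp
  then have "sqrt DIM('a) < norm z" by (simp add: mult_less_cancel_right)
  then have "(sqrt DIM('a))\<^sup>2 < (norm z)\<^sup>2" by (intro power_strict_mono) auto
  then have zz: "DIM('a) < z \<bullet> z" by (simp add: power2_norm_eq_inner)
  \<comment> \<open>The midpoint of \<open>1\<close> and
    \<open>(z \<bullet> z) / DIM('a)\<close>.\<close>
  define \<alpha> where "\<alpha> = (1 + (z \<bullet> z) / DIM('a)) / 2"
  have \<alpha>: "1 < \<alpha>" "\<alpha> * DIM('a) < z \<bullet> z" using zz by (auto simp: \<alpha>_def field_simps)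
  let ?H = "\<lambda>x. \<alpha> *\<^sub>R x - (z \<bullet> x) *\<^sub>R z"
  have "linear ?H" by (rule linearI) (auto simp: algebra_simps inner_add_right)
  moreover have "tr ?H < 0" using \<alpha> by (simp only: tr_diff tr_scaleR tr_rank_one tr_ident)
  ultimately obtain w where w: "norm w = 1" "N w = 1" "w \<bullet> ?H w \<le> 0" using John by blast
  have "\<bar>z \<bullet> w\<bar> \<le> 1" using z(1)[of w] z(1)[of "- w"] w(2) is_norm_props(5)[OF N, of w] by simp
  then have "(z \<bullet> w)\<^sup>2 \<le> 1" by (simp add: abs_square_le_1)
  moreover have "w \<bullet> ?H w = \<alpha> - (z \<bullet> w)\<^sup>2"
    using w(1) by (simp add: inner_diff_right norm_eq_1 power2_eq_square inner_commute)
  ultimately show False using w(3) \<alpha>(1) by simp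
qed

lemma John_position:
  fixes N :: "real^'n \<Rightarrow> real"
  assumes N: "is_norm N"
  obtains U :: "real^'n \<Rightarrow> real^'n" where "linear U" "bij U" "is_norm (\<lambda>x. N (U x))"
    "\<And>x. norm x \<le> N (U x)" "\<And>x. N (U x) \<le> sqrt CARD('n) * norm x"
    "\<And>H. linear H \<Longrightarrow> tr H < 0 \<Longrightarrow> \<exists>w. norm w = 1 \<and> N (U w) = 1 \<and> w \<bullet> H w \<le> 0"
proof -
  obtain U :: "real^'n \<Rightarrow> real^'n" where U: "linear U" "bij U" and low: "\<And>x. norm x \<le> N (U x)"
    and max: "\<And>S::real^'n^'n. (\<And>x. norm (S *v x) \<le> N (U x)) \<Longrightarrow> det S \<le> 1"
    using exists_extremal_position[OF N] by metis
  have NU: "is_norm (\<lambda>x. N (U x))" by (rule is_norm_comp[OF N U(1) bij_is_inj[OF U(2)]])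
  have John: "\<exists>w. norm w = 1 \<and> N (U w) = 1 \<and> w \<bullet> H w \<le> 0" if "linear H" "tr H < 0" for H
    by (rule contact_point[OF NU low max that])
  have up: "N (U x) \<le> sqrt CARD('n) * norm x" for x
    using contact_point_upper[OF NU John, of x] by simp
  show thesis by (rule that[OF U NU low up John])
qed

section \<open>The Banach-Mazur distance\<close>

lemma op_norm_le:
  assumes "is_norm N" "is_norm M" "linear T" "0 \<le> c" "\<And>x. M (T x) \<le> c * N x"
  shows "op_norm N M T \<le> c"
  unfolding op_norm_def
proof (rule cSUP_least)
  fix x
  show "M (T x) / N x \<le> c"
  proof (cases "x = 0")
    case True
    then show ?thesis using assms(4) by (simp add: is_norm_props(4)[OF assms(1)])
  next
    case False
    then show ?thesis using assms(5)[of x] is_norm_props(7)[OF assms(1) False]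
      by (simp add: pos_divide_le_eq)
  qed
qed simp

lemma op_norm_bound:
  fixes N :: "'a::euclidean_space \<Rightarrow> real" and M :: "'b::euclidean_space \<Rightarrow> real"
  assumes N: "is_norm N" and M: "is_norm M" and T: "linear T"
  shows "M (T x) \<le> op_norm N M T * N x" "0 \<le> op_norm N M T"
proof -
  obtain L where L: "0 < L" "\<And>x. M x \<le> L * norm x" using is_norm_upper[OF M] by blast
  obtain B where B: "0 < B" "\<And>x. norm (T x) \<le> B * norm x" using linear_bounded_pos[OF T] by blast
  obtain c where c: "0 < c" "\<And>x. c * norm x \<le> N x" using is_norm_lower[OF N] by blast
  have "M (T x) / N x \<le> L * B / c" for x
  proof (cases "x = 0")
    case True
    then show ?thesis using L B c by (simp add: is_norm_props(4)[OF N])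
  next
    case False
    have "M (T x) \<le> L * (B * norm x)"
      using L(2)[of "T x"] mult_left_mono[OF B(2)[of x], of L] L(1) by linarith
    also have "\<dots> = (L * B / c) * (c * norm x)" using c(1) by simp
    also have "\<dots> \<le> (L * B / c) * N x" using L B c by (intro mult_left_mono) auto
    finally show ?thesis using is_norm_props(7)[OF N False] by (simp add: pos_divide_le_eq)
  qed
  then have bdd: "bdd_above (range (\<lambda>x. M (T x) / N x))" by (intro bdd_aboveI[of _ "L * B / c"]) auto
  have up: "M (T x) / N x \<le> op_norm N M T" for x
    unfolding op_norm_def by (rule cSUP_upper[OF _ bdd]) simp
  show "0 \<le> op_norm N M T" using up[of 0] by (simp add: is_norm_props(4)[OF N])
  show "M (T x) \<le> op_norm N M T * N x"
  proof (cases "x = 0")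
    case True
    then show ?thesis by (simp add: is_norm_props(4)[OF N] is_norm_props(4)[OF M] linear_0[OF T])
  next
    case False
    then show ?thesis using up[of x] is_norm_props(7)[OF N False] by (simp add: pos_divide_le_eq)
  qed
qed

lemma linear_inv:
  assumes "linear T" "bij T" shows "linear (inv T)"
proof (rule linearI)
  have s: "T (inv T x) = x" for x using assms(2) by (simp add: bij_is_surj surj_f_inv_f)
  have i: "inj T" using assms(2) by (rule bij_is_inj)
  show "inv T (x + y) = inv T x + inv T y" for x y
    by (rule injD[OF i]) (simp add: s linear_add[OF assms(1)])
  show "inv T (c *\<^sub>R x) = c *\<^sub>R inv T x" for c x
    by (rule injD[OF i]) (simp add: s linear_cmul[OF assms(1)])
qed

lemma bm_dist_le:
  fixes N :: "'a::euclidean_space \<Rightarrow> real" and M :: "'b::euclidean_space \<Rightarrow> real"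
  assumes N: "is_norm N" and M: "is_norm M" and T: "linear T" "bij T" and "0 \<le> a" "0 \<le> b"
    and ab: "\<And>x. M (T x) \<le> a * N x" "\<And>x. N x \<le> b * M (T x)"
  shows "bm_dist N M \<le> a * b"
proof -
  have li: "linear (inv T)" by (rule linear_inv[OF T])
  have "op_norm N M T \<le> a" by (rule op_norm_le) fact+
  moreover have "op_norm M N (inv T) \<le> b"
  proof (rule op_norm_le[OF M N li \<open>0 \<le> b\<close>])
    show "N (inv T x) \<le> b * M x" for x
      using ab(2)[of "inv T x"] T(2) by (simp add: bij_is_surj surj_f_inv_f)
  qed
  ultimately have "op_norm N M T * op_norm M N (inv T) \<le> a * b"
    by (intro mult_mono op_norm_bound(2)[OF M N li] \<open>0 \<le> a\<close>)
  moreover have "bm_dist N M \<le> op_norm N M T * op_norm M N (inv T)"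
    unfolding bm_dist_def
  proof (rule cInf_lower)
    show "bdd_below {op_norm N M T * op_norm M N (inv T) |T. linear T \<and> bij T}"
      by (rule bdd_belowI[of _ 0])
        (auto intro!: mult_nonneg_nonneg op_norm_bound(2) N M linear_inv)
  qed (use T in blast)
  ultimately show ?thesis by simp
qed

lemma bm_dist_less:
  fixes N M :: "'a::euclidean_space \<Rightarrow> real"
  assumes N: "is_norm N" and M: "is_norm M" and r: "bm_dist N M < r"
  obtains T a b where "linear T" "bij T" "0 \<le> a" "0 \<le> b" "a * b < r"
    "\<And>x. M (T x) \<le> a * N x" "\<And>x. N x \<le> b * M (T x)"
proof -
  \<comment> \<open>\<open>id\<close> shows that the set is nonempty, so its infimum is approached
    by actual isomorphisms.\<close>
  have "op_norm N M id * op_norm M N (inv id)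
      \<in> {op_norm N M T * op_norm M N (inv T) |T. linear T \<and> bij T}"
    using linear_id bij_id by blast
  then have "{op_norm N M T * op_norm M N (inv T) |T. linear T \<and> bij T} \<noteq> {}" by blast
  from cInf_lessD[OF this r[unfolded bm_dist_def]]
  obtain T where T: "linear T" "bij T" and less: "op_norm N M T * op_norm M N (inv T) < r" by blast
  have li: "linear (inv T)" by (rule linear_inv[OF T])
  show thesis
  proof (rule that[OF T _ _ less])
    show "N x \<le> op_norm M N (inv T) * M (T x)" for x
      using op_norm_bound(1)[OF M N li, of "T x"] T(2) by (simp add: bij_is_inj)
  qed (auto intro: op_norm_bound N M T li)
qed

text \<open>Precomposing a near-optimal map for \<open>N\<close> with \<open>U\<close> loses at most
  the factor \<open>s * t\<close>. The case \<open>s = t = 1\<close> gives isometry invariance, and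
  \<open>s = t = 1 + e\<close> gives continuity in the norm.\<close>

lemma bm_dist_compare:
  fixes N N' M :: "'a::euclidean_space \<Rightarrow> real"
  assumes N: "is_norm N" and N': "is_norm N'" and M: "is_norm M" and U: "linear U" "bij U"
    and s: "0 \<le> s" "\<And>x. N' x \<le> s * N (U x)" and t: "0 \<le> t" "\<And>x. N (U x) \<le> t * N' x"
  shows "bm_dist N' M \<le> s * t * bm_dist N M"
proof -
  have *: "bm_dist N' M \<le> s * t * r" if r: "bm_dist N M < r" for r
  proof -
    obtain T a b where T: "linear T" "bij T" and ab: "0 \<le> a" "0 \<le> b" "a * b < r"
      "\<And>x. M (T x) \<le> a * N x" "\<And>x. N x \<le> b * M (T x)"
      using bm_dist_less[OF N M r] by metis
    have "bm_dist N' M \<le> (a * t) * (s * b)"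
    proof (rule bm_dist_le[OF N' M, of "T \<circ> U"])
      show "linear (T \<circ> U)" by (rule linear_compose[OF U(1) T(1)])
      show "bij (T \<circ> U)" by (rule bij_comp[OF U(2) T(2)])
      fix x
      show "M ((T \<circ> U) x) \<le> a * t * N' x"
        using ab(4)[of "U x"] mult_left_mono[OF t(2)[of x] ab(1)] by simp
      show "N' x \<le> s * b * M ((T \<circ> U) x)"
        using s(2)[of x] mult_left_mono[OF ab(5)[of "U x"] s(1)] by simp
    qed (use s t ab in auto)
    also have "\<dots> = s * t * (a * b)" by simp
    also have "\<dots> \<le> s * t * r" using s t ab by (intro mult_left_mono) auto
    finally show ?thesis .
  qed
  show ?thesis
  \<comment> \<open>If \<open>s * t = 0\<close>, a single \<open>r\<close> gives the bound;
    otherwise one divides by \<open>s * t\<close> and lets \<open>r\<close> decrease to the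
    distance.\<close>
  proof (cases "s * t = 0")
    case True
    then show ?thesis using *[of "bm_dist N M + 1"] by (simp only: mult_zero_left)
  next
    case False
    then have st: "0 < s * t" using s t by (simp add: less_le)
    have "bm_dist N' M / (s * t) \<le> bm_dist N M"
    proof (rule dense_ge)
      fix r assume "bm_dist N M < r"
      from *[OF this] show "bm_dist N' M / (s * t) \<le> r"
        using st by (simp add: pos_divide_le_eq mult.commute)
    qed
    then show ?thesis using st by (simp add: pos_divide_le_eq mult.commute)
  qed
qed

lemma bm_dist_isometric:
  fixes N M :: "'a::euclidean_space \<Rightarrow> real" and U :: "'a \<Rightarrow> 'a"
  assumes N: "is_norm N" and M: "is_norm M" and U: "linear U" "bij U"
  shows "bm_dist N M = bm_dist (\<lambda>x. N (U x)) M"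
proof (rule antisym)
  have NU: "is_norm (\<lambda>x. N (U x))" by (rule is_norm_comp[OF N U(1) bij_is_inj[OF U(2)]])
  have "bm_dist N M \<le> 1 * 1 * bm_dist (\<lambda>x. N (U x)) M"
    by (rule bm_dist_compare[OF NU N M linear_inv[OF U] bij_imp_bij_inv[OF U(2)]])
      (use U(2) in \<open>simp_all add: bij_is_surj surj_f_inv_f\<close>)
  then show "bm_dist N M \<le> bm_dist (\<lambda>x. N (U x)) M" by simp
  have "bm_dist (\<lambda>x. N (U x)) M \<le> 1 * 1 * bm_dist N M"
    by (rule bm_dist_compare[OF N NU M U]) simp_all
  then show "bm_dist (\<lambda>x. N (U x)) M \<le> bm_dist N M" by simp
qed

text \<open>Passing from \<open>T\<close> to its inverse swaps the two factors.\<close>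

lemma bm_dist_sym:
  fixes N :: "'a::real_vector \<Rightarrow> real" and M :: "'b::real_vector \<Rightarrow> real"
  shows "bm_dist N M = bm_dist M N"
proof -
  have "{op_norm N M T * op_norm M N (inv T) |T. linear T \<and> bij T}
      = (\<lambda>S. op_norm M N S * op_norm N M (inv S)) ` {S. linear S \<and> bij S}"
    (is "?A = ?B")
  proof safe
    fix T :: "'a \<Rightarrow> 'b" assume T: "linear T" "bij T"
    show "op_norm N M T * op_norm M N (inv T) \<in> ?B"
      using linear_inv[OF T] bij_imp_bij_inv[OF T(2)] inv_inv_eq[OF T(2)]
      by (intro image_eqI[of _ _ "inv T"]) (simp_all add: mult.commute)
  next
    fix S :: "'b \<Rightarrow> 'a" assume S: "linear S" "bij S"
    show "\<exists>T. op_norm M N S * op_norm N M (inv S) = op_norm N M T * op_norm M N (inv T) \<and> linear T \<and> bij T"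
      using linear_inv[OF S] bij_imp_bij_inv[OF S(2)] inv_inv_eq[OF S(2)]
      by (intro exI[of _ "inv S"]) (simp add: mult.commute)
  qed
  also have "?B = {op_norm M N S * op_norm N M (inv S) |S. linear S \<and> bij S}" by blast
  finally show ?thesis unfolding bm_dist_def by simp
qed

section \<open>The upper bound\<close>

lemma is_norm_l1: "is_norm l1_norm"
  unfolding is_norm_def l1_norm_def
proof (intro conjI allI)
  show "((\<Sum>i\<in>UNIV. \<bar>x $ i\<bar>) = 0) = (x = 0)" for x :: "real^'n"
    by (simp add: sum_nonneg_eq_0_iff vec_eq_iff)
  show "(\<Sum>i\<in>UNIV. \<bar>(x + y) $ i\<bar>) \<le> (\<Sum>i\<in>UNIV. \<bar>x $ i\<bar>) + (\<Sum>i\<in>UNIV. \<bar>y $ i\<bar>)" for x y :: "real^'n"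
    unfolding sum.distrib[symmetric] by (intro sum_mono) (simp add: abs_triangle_ineq)
  show "(\<Sum>i\<in>UNIV. \<bar>(c *\<^sub>R x) $ i\<bar>) = \<bar>c\<bar> * (\<Sum>i\<in>UNIV. \<bar>x $ i\<bar>)" for c and x :: "real^'n"
    by (simp add: abs_mult sum_distrib_left)
qed

lemma sum_abs_le_sqrt_card: "(\<Sum>i\<in>A. \<bar>f i\<bar>) \<le> sqrt (card A) * sqrt (\<Sum>i\<in>A. (f i)\<^sup>2)"
  using L2_set_mult_ineq[of "\<lambda>_. 1" f A] by (simp add: L2_set_def)

lemma cauchy_schwarz_2:
  fixes p q x y :: real
  shows "p * x + q * y \<le> sqrt (p\<^sup>2 + q\<^sup>2) * sqrt (x\<^sup>2 + y\<^sup>2)"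
proof -
  have "(p * x + q * y)\<^sup>2 \<le> (p\<^sup>2 + q\<^sup>2) * (x\<^sup>2 + y\<^sup>2)"
    using zero_le_power2[of "p * y - q * x"] by (simp add: power2_eq_square algebra_simps)
  then show ?thesis by (metis real_le_rsqrt real_sqrt_mult)
qed

text \<open>The basis consists of \<open>S\<close> and of the vectors \<open>v / sqrt n\<close> for an orthonormal basis of the orthogonal
  complement of \<open>S\<close>.\<close>

lemma bm_dist_l1_le:
  fixes N :: "real^'n \<Rightarrow> real"
  assumes N: "is_norm N" and low: "\<And>x. norm x \<le> N x"
    and up: "\<And>x. N x \<le> sqrt CARD('n) * norm x"
    and S: "finite S" "independent S" "\<And>w. w \<in> S \<Longrightarrow> N w \<le> 1"
    and c: "0 < c" "\<And>a. c\<^sup>2 * (\<Sum>w\<in>S. (a w)\<^sup>2) \<le> (norm (\<Sum>w\<in>S. a w *\<^sub>R w))\<^sup>2"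
  shows "bm_dist N (l1_norm :: real^'n \<Rightarrow> real) \<le> sqrt (card S / c\<^sup>2 + (real CARD('n) - card S) * CARD('n))"
proof -
  define n where "n = CARD('n)"
  have n0: "0 < n" by (simp add: n_def)
  define V where "V = {y::real^'n. \<forall>x\<in>span S. orthogonal x y}"
  have sV: "subspace V" unfolding V_def by (rule subspace_orthogonal_to_vectors)
  have dV: "dim V + card S = n"
  proof -
    have "dim {y \<in> UNIV. \<forall>x \<in> span S. orthogonal x y} + dim (span S) = dim (UNIV :: (real^'n) set)"
      by (rule dim_subspace_orthogonal_to_vectors) auto
    then show ?thesis using S(2) by (simp add: V_def dim_eq_card_independent n_def)
  qed
  obtain E where E: "E \<subseteq> V" "pairwise orthogonal E" "\<And>x. x \<in> E \<Longrightarrow> norm x = 1"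
    "independent E" "card E = dim V"
    using orthonormal_basis_subspace[OF sV] by metis
  have fE: "finite E" using E(4) by (rule independent_imp_finite)
  have SE: "w \<bullet> v = 0" if "w \<in> S" "v \<in> E" for w v
    using that E(1) span_base[of w S] by (auto simp: V_def orthogonal_def)
  have disj: "S \<inter> E = {}"
  proof (rule ccontr)
    assume "S \<inter> E \<noteq> {}"
    then obtain v where "v \<in> S" "v \<in> E" by blast
    then show False using SE[of v v] E(3)[of v] by (simp add: norm_eq_1)
  qed
  have "card (S \<union> E) = card (UNIV :: 'n set)"
    using card_Un_disjoint[OF S(1) fE disj] dV E(5) by (simp add: n_def)
  then obtain f where f: "bij_betw f (UNIV :: 'n set) (S \<union> E)"
    using finite_same_card_bij[of "UNIV :: 'n set" "S \<union> E"] S(1) fE by auto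
  define g where "g v = (if v \<in> S then v else (1 / sqrt n) *\<^sub>R v)" for v :: "real^'n"
  define F where "F x = (\<Sum>i\<in>UNIV. x $ i *\<^sub>R g (f i))" for x :: "real^'n"
  have lF: "linear F" unfolding F_def
    by (intro linear_compose_sum ballI linearI) (auto simp: algebra_simps)
  \<comment> \<open>Unit vectors have \<open>N\<close> at most \<open>sqrt n\<close>, which is why
    those of \<open>E\<close> are scaled by \<open>1 / sqrt n\<close>.\<close>
  have g1: "N (g v) \<le> 1" if "v \<in> S \<union> E" for v
  proof (cases "v \<in> S")
    case True
    then show ?thesis using S(3) by (simp add: g_def)
  next
    case False
    then have "norm v = 1" using that E(3) by blast
    then show ?thesis using False up[of v] n0
      by (simp add: g_def is_norm_props(3)[OF N] n_def)
  qed
  have up1: "N (F x) \<le> 1 * l1_norm x" for x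
  proof -
    have "N (F x) \<le> (\<Sum>i\<in>UNIV. N (x $ i *\<^sub>R g (f i)))" unfolding F_def by (rule is_norm_sum[OF N])
    also have "\<dots> \<le> (\<Sum>i\<in>UNIV. \<bar>x $ i\<bar> * 1)"
      using bij_betwE[OF f] by (intro sum_mono) (simp add: is_norm_props(3)[OF N] g1 mult_left_le)
    finally show ?thesis by (simp add: l1_norm_def)
  qed
  define D where "D = sqrt (card S / c\<^sup>2 + (real n - card S) * n)"
  have low1: "l1_norm x \<le> D * norm (F x)" for x
  proof -
    define a where "a v = x $ inv f v" for v
    have af: "a (f i) = x $ i" for i
      using f by (simp add: a_def bij_betw_def inv_f_f)
    define s where "s = (\<Sum>v\<in>S. a v *\<^sub>R v)"
    define e where "e = (\<Sum>v\<in>E. a v *\<^sub>R v)"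
    have "F x = (\<Sum>v\<in>S \<union> E. a v *\<^sub>R g v)"
      unfolding F_def using sum.reindex_bij_betw[OF f, of "\<lambda>v. a v *\<^sub>R g v"] by (simp add: af)
    also have "\<dots> = (\<Sum>v\<in>S. a v *\<^sub>R g v) + (\<Sum>v\<in>E. a v *\<^sub>R g v)"
      by (rule sum.union_disjoint) (use S fE disj in auto)
    also have "(\<Sum>v\<in>S. a v *\<^sub>R g v) = s" by (simp add: s_def g_def)
    also have "(\<Sum>v\<in>E. a v *\<^sub>R g v) = (1 / sqrt n) *\<^sub>R e"
      unfolding e_def scaleR_sum_right using disj by (intro sum.cong) (auto simp: g_def)
    finally have F: "F x = s + (1 / sqrt n) *\<^sub>R e" .
    have "s \<bullet> e = 0"
      unfolding s_def e_def inner_sum_left inner_sum_right by (simp add: SE)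
    then have "orthogonal s ((1 / sqrt n) *\<^sub>R e)" by (simp add: orthogonal_def)
    from norm_add_Pythagorean[OF this]
    have nF: "(norm (F x))\<^sup>2 = (norm s)\<^sup>2 + (norm e / sqrt n)\<^sup>2" by (simp add: F)
    have ne: "(norm e)\<^sup>2 = (\<Sum>v\<in>E. (a v)\<^sup>2)"
    proof -
      have "(norm e)\<^sup>2 = (\<Sum>v\<in>E. (norm (a v *\<^sub>R v))\<^sup>2)"
        unfolding e_def using E(2) fE
        by (intro norm_sum_Pythagorean) (auto simp: pairwise_def orthogonal_def)
      then show ?thesis using E(3) by (simp add: power_mult_distrib)
    qed
    \<comment> \<open>Cauchy-Schwarz over \<open>S\<close> and over \<open>E\<close> compares the
      two partial sums with \<open>norm s\<close> and \<open>norm e\<close>. As \<open>s\<close> and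
      \<open>e\<close> are orthogonal, a last Cauchy-Schwarz bounds the total by
      \<open>norm (F x)\<close>.\<close>
    have "l1_norm x = (\<Sum>v\<in>S \<union> E. \<bar>a v\<bar>)"
      unfolding l1_norm_def using sum.reindex_bij_betw[OF f, of "\<lambda>v. \<bar>a v\<bar>"] by (simp add: af)
    also have "\<dots> = (\<Sum>v\<in>S. \<bar>a v\<bar>) + (\<Sum>v\<in>E. \<bar>a v\<bar>)"
      by (rule sum.union_disjoint) (use S fE disj in auto)
    also have "(\<Sum>v\<in>S. \<bar>a v\<bar>) \<le> sqrt (card S) / c * norm s"
    proof -
      have "c * sqrt (\<Sum>v\<in>S. (a v)\<^sup>2) \<le> norm s"
        using c(2)[of a] c(1) real_sqrt_le_mono[OF c(2)[of a]] by (simp add: real_sqrt_mult s_def)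
      then have "sqrt (card S) * sqrt (\<Sum>v\<in>S. (a v)\<^sup>2) \<le> sqrt (card S) * (norm s / c)"
        using c(1) by (intro mult_left_mono) (simp_all add: field_simps)
      then show ?thesis using sum_abs_le_sqrt_card[of a S] by simp
    qed
    also have "(\<Sum>v\<in>E. \<bar>a v\<bar>) \<le> sqrt (card E) * norm e"
      using sum_abs_le_sqrt_card[of a E] by (simp flip: ne)
    also have "sqrt (card E) * norm e = (sqrt (card E) * sqrt n) * (norm e / sqrt n)"
      using n0 by simp
    also have "sqrt (card S) / c * norm s + (sqrt (card E) * sqrt n) * (norm e / sqrt n)
      \<le> sqrt ((sqrt (card S) / c)\<^sup>2 + (sqrt (card E) * sqrt n)\<^sup>2) * sqrt ((norm s)\<^sup>2 + (norm e / sqrt n)\<^sup>2)"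
      by (rule cauchy_schwarz_2)
    also have "\<dots> = D * norm (F x)"
    proof -
      have "real (card E) = real n - card S" using dV E(5) by linarith
      then show ?thesis unfolding nF[symmetric] D_def
        by (simp add: power_divide power_mult_distrib)
    qed
    finally show ?thesis by simp
  qed
  have "x = 0" if "F x = 0" for x
    using low1[of x] that is_norm_props(6,1)[OF is_norm_l1, of x] by simp
  then have "inj F" using linear_injective_0[OF lF] by blast
  then have bF: "bij F" using linear_injective_imp_surjective[OF lF] by (simp add: bij_def)
  have D0: "0 \<le> D" unfolding D_def using dV c(1) by simp
  have "bm_dist (l1_norm :: real^'n \<Rightarrow> real) N \<le> 1 * D"
  proof (rule bm_dist_le[OF is_norm_l1 N lF bF])
    show "l1_norm x \<le> D * N (F x)" for x
      using low1[of x] mult_left_mono[OF low[of "F x"] D0] by simp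
    show "N (F x) \<le> 1 * l1_norm x" for x by (rule up1)
  qed (use D0 in auto)
  then show ?thesis by (simp add: bm_dist_sym[of N] D_def n_def)
qed

lemma bm_dist_l1_bound:
  fixes X :: "real^'n \<Rightarrow> real"
  assumes X: "is_norm X"
  shows "bm_dist X (l1_norm :: real^'n \<Rightarrow> real) \<le> (2 * real CARD('n)) powr (5 / 6)"
proof -
  define n where "n = real CARD('n)"
  have n1: "1 \<le> n" unfolding n_def using zero_less_card_finite[where 'a='n] by linarith
  obtain U :: "real^'n \<Rightarrow> real^'n" where U: "linear U" "bij U" and N: "is_norm (\<lambda>x. X (U x))"
    and low: "\<And>x. norm x \<le> X (U x)" and up: "\<And>x. X (U x) \<le> sqrt CARD('n) * norm x"
    and John: "\<And>H. linear H \<Longrightarrow> tr H < 0 \<Longrightarrow> \<exists>w. norm w = 1 \<and> X (U w) = 1 \<and> w \<bullet> H w \<le> 0"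
    using John_position[OF X] by blast
  let ?N = "\<lambda>x. X (U x)"
  \<comment> \<open>The choice \<open>2 * n * \<epsilon>^3 = 1\<close> balances the main terms
    \<open>n / \<epsilon>^2\<close> and \<open>2 * \<epsilon> * n^2\<close> of the squared
    distortion.\<close>
  define \<epsilon> where "\<epsilon> = (2 * n) powr (-1/3)"
  have \<epsilon>: "0 < \<epsilon>" "\<epsilon> < 1" using n1 by (auto simp: \<epsilon>_def powr_less_one)
  have e3: "2 * n * \<epsilon>^3 = 1"
  proof -
    have "\<epsilon>^3 = (2 * n) powr (-1)" using n1 by (simp add: \<epsilon>_def powr_power)
    also have "\<dots> = 1 / (2 * n)" using n1 by (simp add: powr_minus_divide)
    finally show ?thesis using n1 by simp
  qed
  define k where "k = nat \<lfloor>(1 - \<epsilon>)\<^sup>2 * n\<rfloor>"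
  have k0: "0 \<le> (1 - \<epsilon>)\<^sup>2 * n" using n1 by simp
  have k: "real k \<le> (1 - \<epsilon>)\<^sup>2 * n" "(1 - \<epsilon>)\<^sup>2 * n \<le> k + 1"
    unfolding k_def using k0 by (auto simp: of_nat_nat) linarith+
  let ?C = "{w. norm w = 1 \<and> ?N w = 1}"
  obtain S where S: "finite S" "card S = k" "S \<subseteq> ?C" "independent S"
    "\<And>a. \<epsilon>\<^sup>2 * (\<Sum>w\<in>S. (a w)\<^sup>2) \<le> (norm (\<Sum>w\<in>S. a w *\<^sub>R w))\<^sup>2"
  proof (rule restricted_invertibility[of ?C \<epsilon> k])
    show "\<exists>w\<in>?C. w \<bullet> H w \<le> 0" if "linear H" "tr H < 0" for H using John[OF that] by blast
    show "real k \<le> (1 - \<epsilon>)\<^sup>2 * real DIM(real^'n)" using k by (simp add: n_def)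
  qed (use \<epsilon> in auto)
  have "bm_dist ?N (l1_norm :: real^'n \<Rightarrow> real) \<le> sqrt (card S / \<epsilon>\<^sup>2 + (real CARD('n) - card S) * CARD('n))"
    by (rule bm_dist_l1_le[OF N low up S(1,4) _ \<epsilon>(1) S(5)]) (use S(3) in auto)
  also have "\<dots> = sqrt (k / \<epsilon>\<^sup>2 + (n - k) * n)" by (simp add: S(2) n_def)
  also have "\<dots> \<le> sqrt (1 / \<epsilon>^5)"
  proof (rule real_sqrt_le_mono)
    \<comment> \<open>\<open>k\<close> is bounded from above in the first term and from below in the
      second, where rounding down costs at most \<open>n\<close>.\<close>
    have "k / \<epsilon>\<^sup>2 + (n - k) * n \<le> ((1 - \<epsilon>)\<^sup>2 * n) / \<epsilon>\<^sup>2 + (n - ((1 - \<epsilon>)\<^sup>2 * n - 1)) * n"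
      using k n1 \<epsilon> by (intro add_mono divide_right_mono mult_right_mono) auto
    \<comment> \<open>Here \<open>n = 1 / (2 * \<epsilon>^3)\<close>. The rounding loss is part of
      the \<open>\<epsilon>^2\<close> term, which \<open>5 / 4 * \<epsilon>\<close>
      outweighs.\<close>
    also have "\<dots> = (1 - 5 / 4 * \<epsilon> + \<epsilon>\<^sup>2) / \<epsilon>^5"
    proof -
      have n: "n = 1 / (2 * \<epsilon>^3)" using e3 \<epsilon> by (simp add: field_simps)
      show ?thesis unfolding n using \<epsilon>(1)
        by (simp add: field_simps power2_eq_square power3_eq_cube power_numeral_reduce)
    qed
    also have "\<dots> \<le> 1 / \<epsilon>^5"
    proof (rule divide_right_mono)
      have "\<epsilon> * \<epsilon> \<le> 1 * \<epsilon>" using \<epsilon> by (intro mult_right_mono) auto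
      then show "1 - 5 / 4 * \<epsilon> + \<epsilon>\<^sup>2 \<le> 1" using \<epsilon> by (simp add: power2_eq_square)
    qed (use \<epsilon> in simp)
    finally show "k / \<epsilon>\<^sup>2 + (n - k) * n \<le> 1 / \<epsilon>^5" .
  qed
  also have "1 / \<epsilon>^5 = (2 * n) powr (5 / 3)"
  proof -
    have "\<epsilon>^5 = (2 * n) powr (- (5 / 3))" using n1 by (simp add: \<epsilon>_def powr_power)
    then show ?thesis by (simp add: powr_minus_divide)
  qed
  also have "sqrt \<dots> = (2 * n) powr (5 / 6)"
    using n1 by (simp add: powr_half_sqrt[symmetric] powr_powr)
  finally have *: "bm_dist ?N (l1_norm :: real^'n \<Rightarrow> real) \<le> (2 * n) powr (5 / 6)" .
  have "bm_dist X (l1_norm :: real^'n \<Rightarrow> real) = bm_dist ?N (l1_norm :: real^'n \<Rightarrow> real)"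
    by (rule bm_dist_isometric[OF X is_norm_l1 U])
  with * show ?thesis by (simp add: n_def)
qed

section \<open>Duality\<close>

text \<open>Functionals are represented by vectors through the inner product, so the dual norm lives
  on the same space. The quotient at \<open>x = 0\<close> is \<open>0\<close>.\<close>

definition dual_norm :: "('a::euclidean_space \<Rightarrow> real) \<Rightarrow> 'a \<Rightarrow> real" where
  "dual_norm N y = (SUP x. (y \<bullet> x) / N x)"

lemma dual_norm_le:
  assumes N: "is_norm N" and "0 \<le> c" "\<And>x. y \<bullet> x \<le> c * N x"
  shows "dual_norm N y \<le> c"
  unfolding dual_norm_def
proof (rule cSUP_least)
  show "(y \<bullet> x) / N x \<le> c" for x
    using assms(2) assms(3)[of x] is_norm_props(7)[OF N, of x]
    by (cases "x = 0") (simp_all add: pos_divide_le_eq)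
qed simp

lemma dual_norm_bound:
  assumes N: "is_norm N"
  shows "y \<bullet> x \<le> dual_norm N y * N x" "0 \<le> dual_norm N y"
proof -
  obtain c where c: "0 < c" "\<And>x. c * norm x \<le> N x" using is_norm_lower[OF N] by blast
  have "(y \<bullet> x) / N x \<le> norm y / c" for x
  proof (cases "x = 0")
    case False
    have "y \<bullet> x \<le> (norm y / c) * (c * norm x)" using c(1) norm_cauchy_schwarz[of y x] by simp
    also have "\<dots> \<le> (norm y / c) * N x" using c by (intro mult_left_mono) auto
    finally show ?thesis using is_norm_props(7)[OF N False] by (simp add: pos_divide_le_eq)
  qed (use c in simp)
  then have bdd: "bdd_above (range (\<lambda>x. (y \<bullet> x) / N x))" by (intro bdd_aboveI[of _ "norm y / c"]) auto
  have up: "(y \<bullet> x) / N x \<le> dual_norm N y" for x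
    unfolding dual_norm_def by (rule cSUP_upper[OF _ bdd]) simp
  show "0 \<le> dual_norm N y" using up[of 0] by simp
  show "y \<bullet> x \<le> dual_norm N y * N x"
    using up[of x] is_norm_props(7)[OF N, of x] by (cases "x = 0") (simp_all add: pos_divide_le_eq is_norm_props(4)[OF N])
qed

lemma is_norm_dual_norm:
  assumes N: "is_norm N" shows "is_norm (dual_norm N)"
proof -
  note b = dual_norm_bound[OF N]
  have zero: "dual_norm N y = 0 \<longleftrightarrow> y = 0" for y
  proof
    assume "dual_norm N y = 0"
    then have "y \<bullet> y \<le> 0" using b(1)[of y y] by simp
    then show "y = 0" by (metis inner_eq_zero_iff inner_ge_zero order_antisym)
  next
    assume "y = 0"
    then have "dual_norm N y \<le> 0" by (intro dual_norm_le[OF N]) auto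
    then show "dual_norm N y = 0" using b(2)[of y] by simp
  qed
  have scale: "dual_norm N (c *\<^sub>R y) \<le> \<bar>c\<bar> * dual_norm N y" for c y
  proof (rule dual_norm_le[OF N])
    show "c *\<^sub>R y \<bullet> x \<le> \<bar>c\<bar> * dual_norm N y * N x" for x
      using b(1)[of y "c *\<^sub>R x"] by (simp add: is_norm_props(3)[OF N] mult_ac)
  qed (simp add: b(2))
  show ?thesis unfolding is_norm_def
  proof (intro conjI allI zero)
    show "dual_norm N (x + y) \<le> dual_norm N x + dual_norm N y" for x y
    proof (rule dual_norm_le[OF N])
      show "(x + y) \<bullet> z \<le> (dual_norm N x + dual_norm N y) * N z" for z
        using b(1)[of x z] b(1)[of y z] by (simp add: inner_add_left distrib_right)
    qed (simp add: b(2))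
    show "dual_norm N (c *\<^sub>R y) = \<bar>c\<bar> * dual_norm N y" for c y
    proof (cases "c = 0")
      case True
      then show ?thesis using zero[of 0] by simp
    next
      case False
      have "dual_norm N y \<le> \<bar>1 / c\<bar> * dual_norm N (c *\<^sub>R y)"
        using scale[of "1 / c" "c *\<^sub>R y"] False by simp
      then have "\<bar>c\<bar> * dual_norm N y \<le> dual_norm N (c *\<^sub>R y)"
        using False by (simp add: pos_le_divide_eq mult.commute)
      then show ?thesis using scale[of c y] by simp
    qed
  qed
qed

text \<open>One inequality is formal; for the other, a norming functional of \<open>x\<close> has
  dual norm at most \<open>1\<close>.\<close>

lemma dual_dual_norm:
  assumes N: "is_norm N" shows "dual_norm (dual_norm N) = N"
proof
  fix x
  note D = is_norm_dual_norm[OF N]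
  show "dual_norm (dual_norm N) x = N x"
  proof (rule antisym)
    show "dual_norm (dual_norm N) x \<le> N x"
    proof (rule dual_norm_le[OF D])
      show "x \<bullet> y \<le> N x * dual_norm N y" for y
        using dual_norm_bound(1)[OF N, of y x] by (simp add: inner_commute mult.commute)
    qed (rule is_norm_props(6)[OF N])
    obtain z where z: "\<And>x. z \<bullet> x \<le> N x" "z \<bullet> x = N x" using norming_functional[OF N, of x] by metis
    have "dual_norm N z \<le> 1" by (rule dual_norm_le[OF N]) (simp_all add: z)
    have "N x = x \<bullet> z" using z(2) by (simp add: inner_commute)
    also have "\<dots> \<le> dual_norm (dual_norm N) x * dual_norm N z" by (rule dual_norm_bound(1)[OF D])
    also have "\<dots> \<le> dual_norm (dual_norm N) x * 1"
      using \<open>dual_norm N z \<le> 1\<close> by (intro mult_left_mono dual_norm_bound(2)[OF D])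
    finally show "N x \<le> dual_norm (dual_norm N) x" by simp
  qed
qed

text \<open>The adjoint of \<open>T\<close> is an isomorphism from the dual of \<open>M\<close> to
  the dual of \<open>N\<close> with the same two constants. Biduality later turns the inequality
  into an equality.\<close>

lemma bm_dist_dual_le:
  fixes N M :: "'a::euclidean_space \<Rightarrow> real"
  assumes N: "is_norm N" and M: "is_norm M"
  shows "bm_dist (dual_norm N) (dual_norm M) \<le> bm_dist N M"
proof (rule dense_ge)
  fix r assume r: "bm_dist N M < r"
  obtain T a b where T: "linear T" "bij T" and ab: "0 \<le> a" "0 \<le> b" "a * b < r"
    "\<And>x. M (T x) \<le> a * N x" "\<And>x. N x \<le> b * M (T x)"
    using bm_dist_less[OF N M r] by metis
  have l: "linear (adjoint T)" by (rule adjoint_linear[OF T(1)])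
  have adj: "adjoint T y \<bullet> x = y \<bullet> T x" for x y
    using adjoint_works[OF T(1), of x y] by (simp add: inner_commute)
  have "y = 0" if "adjoint T y = 0" for y
  proof -
    obtain x where "T x = y" using T(2) by (metis bij_pointE)
    then have "y \<bullet> y = 0" using adj[of y x] that by simp
    then show ?thesis by simp
  qed
  then have "inj (adjoint T)" using linear_injective_0[OF l] by blast
  then have bij: "bij (adjoint T)" using linear_injective_imp_surjective[OF l] by (simp add: bij_def)
  have "bm_dist (dual_norm M) (dual_norm N) \<le> a * b"
  proof (rule bm_dist_le[OF is_norm_dual_norm[OF M] is_norm_dual_norm[OF N] l bij ab(1,2)])
    fix y
    show "dual_norm N (adjoint T y) \<le> a * dual_norm M y"
    proof (rule dual_norm_le[OF N])
      show "adjoint T y \<bullet> x \<le> a * dual_norm M y * N x" for x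
        using dual_norm_bound(1)[OF M, of y "T x"]
          mult_left_mono[OF ab(4)[of x] dual_norm_bound(2)[OF M, of y]] by (simp add: adj mult_ac)
    qed (simp add: ab dual_norm_bound(2)[OF M])
    show "dual_norm M y \<le> b * dual_norm N (adjoint T y)"
    proof (rule dual_norm_le[OF M])
      fix z
      obtain x where x: "T x = z" using T(2) by (metis bij_pointE)
      show "y \<bullet> z \<le> b * dual_norm N (adjoint T y) * M z"
        using dual_norm_bound(1)[OF N, of "adjoint T y" x]
          mult_left_mono[OF ab(5)[of x] dual_norm_bound(2)[OF N, of "adjoint T y"]]
        by (simp add: adj mult_ac flip: x)
    qed (simp add: ab dual_norm_bound(2)[OF N])
  qed
  then show "bm_dist (dual_norm N) (dual_norm M) \<le> r" using ab(3) by (simp add: bm_dist_sym[of "dual_norm N"])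
qed

lemma bm_dist_dual:
  fixes N M :: "'a::euclidean_space \<Rightarrow> real"
  assumes N: "is_norm N" and M: "is_norm M"
  shows "bm_dist (dual_norm N) (dual_norm M) = bm_dist N M"
  using bm_dist_dual_le[OF N M] bm_dist_dual_le[OF is_norm_dual_norm[OF N] is_norm_dual_norm[OF M]]
  by (simp add: dual_dual_norm[OF N] dual_dual_norm[OF M])

lemma dual_l1_norm: "dual_norm (l1_norm :: real^'n \<Rightarrow> real) = linf_norm"
proof
  fix y :: "real^'n"
  have fin: "finite (range (\<lambda>i. \<bar>y $ i\<bar>))" by simp
  have le: "\<bar>y $ i\<bar> \<le> linf_norm y" for i
    unfolding linf_norm_def by (intro Max_ge fin) blast
  show "dual_norm l1_norm y = linf_norm y"
  proof (rule antisym)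
    show "dual_norm l1_norm y \<le> linf_norm y"
    proof (rule dual_norm_le[OF is_norm_l1])
      show "0 \<le> linf_norm y" using le[of undefined] by linarith
      fix x :: "real^'n"
      have "y \<bullet> x \<le> (\<Sum>i\<in>UNIV. \<bar>y $ i\<bar> * \<bar>x $ i\<bar>)"
        unfolding inner_vec_def by (intro sum_mono) (simp flip: abs_mult)
      also have "\<dots> \<le> (\<Sum>i\<in>UNIV. linf_norm y * \<bar>x $ i\<bar>)"
        by (intro sum_mono mult_right_mono le) simp
      finally show "y \<bullet> x \<le> linf_norm y * l1_norm x" by (simp add: l1_norm_def sum_distrib_left)
    qed
    have "linf_norm y \<in> range (\<lambda>i. \<bar>y $ i\<bar>)" unfolding linf_norm_def by (rule Max_in) auto
    then obtain i where i: "linf_norm y = \<bar>y $ i\<bar>" by blast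
    \<comment> \<open>The signed unit vector at a coordinate of largest modulus norms
      \<open>y\<close>; its l1 norm is only \<open>\<le> 1\<close> because \<open>sgn\<close> may be
      \<open>0\<close>.\<close>
    have "\<bar>y $ i\<bar> = y \<bullet> (sgn (y $ i) *\<^sub>R axis i 1)"
      by (simp add: inner_axis abs_sgn mult.commute)
    also have "\<dots> \<le> dual_norm l1_norm y * l1_norm (sgn (y $ i) *\<^sub>R axis i 1)"
      by (rule dual_norm_bound(1)[OF is_norm_l1])
    also have "\<dots> \<le> dual_norm l1_norm y * 1"
    proof (rule mult_left_mono)
      have "l1_norm (axis i 1 :: real^'n) = 1"
        unfolding l1_norm_def axis_def by (simp add: if_distrib cong: if_cong)
      then show "l1_norm (sgn (y $ i) *\<^sub>R axis i 1 :: real^'n) \<le> 1"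
        by (simp add: is_norm_props(3)[OF is_norm_l1] abs_sgn_eq)
    qed (rule dual_norm_bound(2)[OF is_norm_l1])
    finally show "linf_norm y \<le> dual_norm l1_norm y" using i by simp
  qed
qed

text \<open>\<open>dual_norm\<close> is an involution on norms that exchanges the distances to l1
  and to linf. Equal sets of distances have equal maxima.\<close>

lemma bm_dist_l1_linf_sets:
  "{bm_dist X (l1_norm :: real^'n \<Rightarrow> real) |X :: real^'n \<Rightarrow> real. is_norm X} =
   {bm_dist X (linf_norm :: real^'n \<Rightarrow> real) |X :: real^'n \<Rightarrow> real. is_norm X}"
proof -
  have dual: "bm_dist X (l1_norm :: real^'n \<Rightarrow> real) = bm_dist (dual_norm X) (linf_norm :: real^'n \<Rightarrow> real)"
    if "is_norm X" for X :: "real^'n \<Rightarrow> real"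
    using bm_dist_dual[OF that is_norm_l1] by (simp add: dual_l1_norm)
  have "bm_dist X (linf_norm :: real^'n \<Rightarrow> real) = bm_dist (dual_norm X) (l1_norm :: real^'n \<Rightarrow> real)"
    if "is_norm X" for X :: "real^'n \<Rightarrow> real"
    using dual[OF is_norm_dual_norm[OF that]] by (simp add: dual_dual_norm[OF that])
  with dual show ?thesis by (blast intro: is_norm_dual_norm)
qed

section \<open>Attainment of the maximum\<close>

text \<open>The limit that Arzela-Ascoli provides on the unit ball is extended from the sphere by homogeneity.\<close>

lemma norms_sequentially_compact:
  fixes N :: "nat \<Rightarrow> 'a::euclidean_space \<Rightarrow> real"
  assumes N: "\<And>j. is_norm (N j)" and low: "\<And>j x. norm x \<le> N j x"
    and up: "\<And>j x. N j x \<le> L * norm x"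
  obtains M k where "is_norm M" "strict_mono (k :: nat \<Rightarrow> nat)"
    "\<And>e. 0 < e \<Longrightarrow> \<exists>J. \<forall>j\<ge>J. \<forall>x. \<bar>N (k j) x - M x\<bar> \<le> e * norm x"
    "\<And>x. norm x \<le> M x" "\<And>x. M x \<le> L * norm x"
proof -
  \<comment> \<open>A common Lipschitz constant provides the equicontinuity for
    Arzela-Ascoli.\<close>
  have lip: "\<bar>N j x - N j y\<bar> \<le> \<bar>L\<bar> * norm (x - y)" for j x y
    using is_norm_props(8)[OF N, of j x y] up[of j "x - y"]
      mult_right_mono[OF abs_ge_self[of L] norm_ge_zero[of "x - y"]] by linarith
  obtain g k where k: "strict_mono (k :: nat \<Rightarrow> nat)"
    and conv: "\<And>e. 0 < e \<Longrightarrow> \<exists>J. \<forall>j x. j \<ge> J \<and> x \<in> cball 0 1 \<longrightarrow> norm (N (k j) x - g x) < e"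
  proof (rule Arzela_Ascoli[of "cball 0 1" N "\<bar>L\<bar>"])
    show "norm (N j x) \<le> \<bar>L\<bar>" if "x \<in> cball 0 1" for j x
      using lip[of j x 0] that mult_left_mono[of "norm x" 1 "\<bar>L\<bar>"]
      by (simp add: is_norm_props(4)[OF N])
    show "\<exists>d>0. \<forall>j y. y \<in> cball 0 1 \<and> norm (x - y) < d \<longrightarrow> norm (N j x - N j y) < e"
      if "0 < e" for x e
    proof (intro exI[of _ "e / (\<bar>L\<bar> + 1)"] conjI allI impI)
      fix j y assume "y \<in> cball 0 1 \<and> norm (x - y) < e / (\<bar>L\<bar> + 1)"
      then have "(\<bar>L\<bar> + 1) * norm (x - y) < e" by (simp add: pos_less_divide_eq mult.commute)
      then show "norm (N j x - N j y) < e"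
        using lip[of j x y] norm_ge_zero[of "x - y"] unfolding real_norm_def distrib_right
        by linarith
    qed (use that in simp)
  qed (auto intro: that)
  define M where "M x = norm x * g ((1 / norm x) *\<^sub>R x)" for x
  have unif: "\<exists>J. \<forall>j\<ge>J. \<forall>x. \<bar>N (k j) x - M x\<bar> \<le> e * norm x" if e: "0 < e" for e
  proof -
    obtain J where J: "\<And>j x. j \<ge> J \<Longrightarrow> x \<in> cball 0 1 \<Longrightarrow> norm (N (k j) x - g x) < e"
      using conv[OF e] by blast
    have "\<bar>N (k j) x - M x\<bar> \<le> e * norm x" if "j \<ge> J" for j x
    proof (cases "x = 0")
      case True
      then show ?thesis by (simp add: M_def is_norm_props(4)[OF N])
    next
      case False
      let ?u = "(1 / norm x) *\<^sub>R x"
      have "N (k j) x = norm x * N (k j) ?u" using False by (simp add: is_norm_props(3)[OF N])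
      then have "\<bar>N (k j) x - M x\<bar> = norm x * \<bar>N (k j) ?u - g ?u\<bar>"
        by (simp add: M_def abs_mult flip: right_diff_distrib)
      also have "\<dots> \<le> norm x * e" using J[OF that, of ?u] False by (intro mult_left_mono) auto
      finally show ?thesis by (simp add: mult.commute)
    qed
    then show ?thesis by blast
  qed
  have lim: "(\<lambda>j. N (k j) x) \<longlonglongrightarrow> M x" for x
  proof (rule LIMSEQ_I)
    fix r :: real assume r: "0 < r"
    define e where "e = r / (norm x + 1)"
    have e: "0 < e" "e * norm x < r"
      using r norm_ge_zero[of x] unfolding e_def
      by (simp_all add: add_nonneg_pos pos_divide_less_eq)
    show "\<exists>J. \<forall>j\<ge>J. norm (N (k j) x - M x) < r"
      using unif[OF e(1)] e(2) by (metis order_le_less_trans real_norm_def)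
  qed
  \<comment> \<open>The uniform bounds pass to the limit; the lower one keeps \<open>M\<close>
    definite.\<close>
  have lowM: "norm x \<le> M x" for x using LIMSEQ_le_const[OF lim[of x]] low by blast
  have upM: "M x \<le> L * norm x" for x using LIMSEQ_le_const2[OF lim[of x]] up by blast
  have "is_norm M" unfolding is_norm_def
  proof (intro conjI allI)
    show "(M x = 0) = (x = 0)" for x using lowM[of x] upM[of x] by auto
    show "M (x + y) \<le> M x + M y" for x y
      by (rule LIMSEQ_le[OF lim tendsto_add[OF lim lim]]) (auto intro: is_norm_props(2)[OF N])
    show "M (c *\<^sub>R x) = \<bar>c\<bar> * M x" for c x
      using LIMSEQ_unique[OF lim[of "c *\<^sub>R x"]] tendsto_mult_left[OF lim[of x], of "\<bar>c\<bar>"]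
      by (simp add: is_norm_props(3)[OF N])
  qed
  then show thesis using that[OF _ k unif lowM upM] by blast
qed

lemma bm_dist_l1_attains_max:
  "\<exists>R. is_max R {bm_dist X (l1_norm :: real^'n \<Rightarrow> real) |X :: real^'n \<Rightarrow> real. is_norm X}"
proof -
  let ?d = "\<lambda>X :: real^'n \<Rightarrow> real. bm_dist X (l1_norm :: real^'n \<Rightarrow> real)"
  define K where "K = {X :: real^'n \<Rightarrow> real. is_norm X \<and> (\<forall>x. norm x \<le> X x) \<and> (\<forall>x. X x \<le> sqrt CARD('n) * norm x)}"
  have red: "\<exists>Y\<in>K. ?d X \<le> ?d Y" if X: "is_norm X" for X :: "real^'n \<Rightarrow> real"
  proof -
    obtain U :: "real^'n \<Rightarrow> real^'n" where U: "linear U" "bij U" and N: "is_norm (\<lambda>x. X (U x))"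
      and low: "\<And>x. norm x \<le> X (U x)" and up: "\<And>x. X (U x) \<le> sqrt CARD('n) * norm x"
      by (rule John_position[OF X]) (rule that)
    have "?d X = ?d (\<lambda>x. X (U x))" by (rule bm_dist_isometric[OF X is_norm_l1 U])
    then show ?thesis using N low up by (intro bexI[of _ "\<lambda>x. X (U x)"]) (auto simp: K_def)
  qed
  define D where "D = ?d ` {X. is_norm X}"
  \<comment> \<open>The upper bound also makes \<open>Sup D\<close> a genuine supremum.\<close>
  have "?d X \<le> (2 * real CARD('n)) powr (5 / 6)" if "is_norm X" for X :: "real^'n \<Rightarrow> real"
    by (rule bm_dist_l1_bound[OF that])
  then have bdd: "bdd_above D" unfolding D_def by (intro bdd_aboveI) auto
  have ne: "D \<noteq> {}" unfolding D_def using is_norm_l1[where 'a='n] by blast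
  have "\<exists>X\<in>K. Sup D - 1 / Suc j < ?d X" for j
  proof -
    have "Sup D - 1 / Suc j < Sup D" by simp
    then obtain X where X: "is_norm X" "Sup D - 1 / Suc j < ?d X"
      using less_cSup_iff[OF ne bdd] unfolding D_def by auto
    then show ?thesis using red[OF X(1)] by (meson order_less_le_trans)
  qed
  then obtain N where NK: "\<And>j. N j \<in> K" and Nd: "\<And>j. Sup D - 1 / Suc j < ?d (N j)" by metis
  have N: "is_norm (N j)" "norm x \<le> N j x" "N j x \<le> sqrt CARD('n) * norm x" for j x
    using NK[of j] by (auto simp: K_def)
  obtain M k where M: "is_norm M" and k: "strict_mono (k :: nat \<Rightarrow> nat)"
    and unif: "\<And>e. 0 < e \<Longrightarrow> \<exists>J. \<forall>j\<ge>J. \<forall>x. \<bar>N (k j) x - M x\<bar> \<le> e * norm x"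
    and low: "\<And>x. norm x \<le> M x" and up: "\<And>x. M x \<le> sqrt CARD('n) * norm x"
    using norms_sequentially_compact[of N "sqrt CARD('n)", OF N] by blast
  have dN: "(\<lambda>j. Sup D - 1 / Suc (k j)) \<longlonglongrightarrow> Sup D - 0"
    using LIMSEQ_subseq_LIMSEQ[OF LIMSEQ_inverse_real_of_nat k]
    by (intro tendsto_diff tendsto_const) (simp add: o_def inverse_eq_divide)
  have "Sup D \<le> (1 + e) * (1 + e) * ?d M" if e: "0 < e" for e
  proof -
    obtain J where J: "\<And>j x. j \<ge> J \<Longrightarrow> \<bar>N (k j) x - M x\<bar> \<le> e * norm x" using unif[OF e] by blast
    have "Sup D - 1 / Suc (k j) \<le> (1 + e) * (1 + e) * ?d M" if j: "j \<ge> J" for j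
    proof -
      have "?d (N (k j)) \<le> (1 + e) * (1 + e) * ?d M"
      proof (rule bm_dist_compare[OF M N(1) is_norm_l1 linear_ident bij_id[unfolded id_def]])
        fix x
        \<comment> \<open>Both norms dominate the Euclidean one, so the additive error
          \<open>e * norm x\<close> becomes a factor \<open>1 + e\<close>.\<close>
        have le: "e * norm x \<le> e * M x" "e * norm x \<le> e * N (k j) x"
          using e low[of x] N(2)[of x "k j"] by auto
        show "N (k j) x \<le> (1 + e) * M x" "M x \<le> (1 + e) * N (k j) x"
          using J[OF j, of x] le by (auto simp: distrib_right)
      qed (use e in auto)
      then show ?thesis using Nd[of "k j"] by simp
    qed
    then show ?thesis using LIMSEQ_le_const2[OF dN] by auto
  qed
  note SupD = this
  \<comment> \<open>Take \<open>e = 1 / Suc j\<close> and let \<open>j\<close> grow.\<close>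
  have "Sup D \<le> ?d M"
  proof -
    have "(\<lambda>j. (1 + 1 / Suc j) * (1 + 1 / Suc j) * ?d M) \<longlonglongrightarrow> (1 + 0) * (1 + 0) * ?d M"
      using LIMSEQ_inverse_real_of_nat
      by (intro tendsto_intros) (simp_all add: inverse_eq_divide)
    from LIMSEQ_le_const[OF this, of "Sup D"] show ?thesis using SupD by auto
  qed
  then have "?d X \<le> ?d M" if "is_norm X" for X :: "real^'n \<Rightarrow> real"
    using cSup_upper[OF _ bdd, of "?d X"] that unfolding D_def by force
  then show ?thesis unfolding is_max_def using M by blast
qed

theorem theorem3p7:
  "\<exists>R_1 R_inf :: real.
     is_max R_1 {bm_dist X (l1_norm :: real ^ 'n \<Rightarrow> real) | X :: real ^ 'n::finite \<Rightarrow> real. is_norm X} \<and>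
     is_max R_inf {bm_dist X (linf_norm :: real ^ 'n \<Rightarrow> real) | X :: real ^ 'n::finite \<Rightarrow> real. is_norm X} \<and>
     R_1 = R_inf \<and>
     R_inf \<le> (2 * real CARD('n)) powr (5 / 6)"
proof -
  obtain R where R: "is_max R {bm_dist X (l1_norm :: real ^ 'n \<Rightarrow> real) | X :: real ^ 'n \<Rightarrow> real. is_norm X}"
    using bm_dist_l1_attains_max by blast
  then have "R \<le> (2 * real CARD('n)) powr (5 / 6)"
    using bm_dist_l1_bound unfolding is_max_def by blast
  with R show ?thesis unfolding bm_dist_l1_linf_sets by blast
qed

end
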